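(* Let $X$ be a Tychonoff space and let $E\subseteq c_0$ be a non-zero symmetric sequence ideal. The following conditions are equivalent: (i) there exists a continuous linear surjection $C_p(X)\to E_p$; (ii) $E=c_0$ and $C_p(X)$ has the Josefson--Nissenzweig property; (iii) $E=c_0$ and $C_p(X)$ contains a complemented subspace isomorphic to $(c_0)_p$; (iv) $E=c_0$ and $C_p(X)$ has a quotient isomorphic to $(c_0)_p$.
   Context: All vector spaces are real; sequences are indexed by $\mathbb{N}=\{1,2,\dots\}$. $c_0$ is the space of real sequences converging to $0$. For a Tychonoff (completely regular Hausdorff) space $X$, $C_p(X)$ is the vector space $C(X)$ of all continuous real-valued functions on $X$ with the topology of pointwise convergence. Its dual $C_p(X)^*$ consists of the finitely supported sign-measures $\mu=\sum_{x\in F}\alpha_x\delta_x$, where $F\subseteq X$ is finite, the $\alpha_x$ are non-zero reals, and $\delta_x(f)=f(x)$; the norm of such $\mu$ is $\|\mu\|=\sum_{x\in F}|\alpha_x|$. The space $C_p(X)$ has the Josefson--Nissenzweig property if there is a sequence $(\nu_n)\subseteq C_p(X)^*$ with $\|\nu_n\|=1$ for all $n\in\mathbb{N}$ and $\nu_n(f)\to0$ for every $f\in C(X)$. For $x=(x_n)\in c_0$ the decreasing rearrangement $x^*=(x_n^* )$ is defined by $x_n^*=\inf_{F\subseteq\mathbb{N},\,|F|<n}\ \sup_{k\notin F}|x_k|$ for $n\in\mathbb{N}$. A linear subspace $E\subseteq c_0$ is called a symmetric sequence ideal if whenever $x\in E$, $y\in c_0$ and $y_n^*\le x_n^*$ for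 every $n$, then $y\in E$. For a linear subspace $E$ of $\mathbb{R}^{\mathbb{N}}$, $E_p$ denotes $E$ with the subspace topology inherited from the product space $\mathbb{R}^{\mathbb{N}}$. "Isomorphic" means linearly homeomorphic, and quotients are quotients by closed linear subspaces with the quotient topology. *)

theory Defs
  imports "HOL-Analysis.Analysis"
begin

section \<open>Real vector spaces with a topology\<close>

text \<open>
  The set of vectors is the topspace of the topology; the operations are meaningful on vectors
  only. The record carries no axioms, since it is only used for the concrete spaces constructed
  below.
\<close>

record 'v top_vec =
  topo :: "'v topology"
  vadd :: "'v \<Rightarrow> 'v \<Rightarrow> 'v"
  vscale :: "real \<Rightarrow> 'v \<Rightarrow> 'v"

abbreviation vecs :: "'v top_vec \<Rightarrow> 'v set" where
  "vecs V \<equiv> topspace (topo V)"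

definition linear_subspace :: "'v top_vec \<Rightarrow> 'v set \<Rightarrow> bool" where
  "linear_subspace V S \<longleftrightarrow>
     S \<subseteq> vecs V \<and> S \<noteq> {} \<and>
     (\<forall>u\<in>S. \<forall>v\<in>S. vadd V u v \<in> S) \<and>
     (\<forall>c. \<forall>v\<in>S. vscale V c v \<in> S)"

definition linear_between :: "'v top_vec \<Rightarrow> 'w top_vec \<Rightarrow> ('v \<Rightarrow> 'w) \<Rightarrow> bool" where
  "linear_between V W T \<longleftrightarrow>
     T ` vecs V \<subseteq> vecs W \<and>
     (\<forall>u\<in>vecs V. \<forall>v\<in>vecs V. T (vadd V u v) = vadd W (T u) (T v)) \<and>
     (\<forall>c. \<forall>v\<in>vecs V. T (vscale V c v) = vscale W c (T v))"

definition isomorphic :: "'v top_vec \<Rightarrow> 'w top_vec \<Rightarrow> bool" where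
  "isomorphic V W \<longleftrightarrow>
     (\<exists>T. linear_between V W T \<and> homeomorphic_map (topo V) (topo W) T)"

definition subspace_of :: "'v top_vec \<Rightarrow> 'v set \<Rightarrow> 'v top_vec" where
  "subspace_of V S = V\<lparr>topo := subtopology (topo V) S\<rparr>"

definition complemented_in :: "'v top_vec \<Rightarrow> 'v set \<Rightarrow> bool" where
  "complemented_in V S \<longleftrightarrow>
     linear_subspace V S \<and>
     (\<exists>P. linear_between V V P \<and> continuous_map (topo V) (topo V) P \<and>
          P ` vecs V = S \<and> (\<forall>v\<in>vecs V. P (P v) = P v))"

definition coset_of :: "'v top_vec \<Rightarrow> 'v set \<Rightarrow> 'v \<Rightarrow> 'v set" where
  "coset_of V N v = vadd V v ` N"

definition quotient_topology :: "'v topology \<Rightarrow> ('v \<Rightarrow> 'w) \<Rightarrow> 'w topology" where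
  "quotient_topology X q =
     topology (\<lambda>U. U \<subseteq> q ` topspace X \<and> openin X {x \<in> topspace X. q x \<in> U})"

text \<open>
  The scalar multiple of a coset \<open>A\<close> is \<open>c A + N\<close> rather than \<open>c A\<close>: the latter is not a coset
  when \<open>c = 0\<close>.
\<close>

definition quotient_space :: "'v top_vec \<Rightarrow> 'v set \<Rightarrow> 'v set top_vec" where
  "quotient_space V N =
     \<lparr>topo = quotient_topology (topo V) (coset_of V N),
      vadd = (\<lambda>A B. {vadd V a b | a b. a \<in> A \<and> b \<in> B}),
      vscale = (\<lambda>c A. {vadd V (vscale V c a) n | a n. a \<in> A \<and> n \<in> N})\<rparr>"

lemma openin_quotient_topology:
  "openin (quotient_topology X q) U \<longleftrightarrow>
     U \<subseteq> q ` topspace X \<and> openin X {x \<in> topspace X. q x \<in> U}"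
proof -
  have "istopology (\<lambda>U. U \<subseteq> q ` topspace X \<and> openin X {x \<in> topspace X. q x \<in> U})"
    unfolding istopology_def
  proof (intro conjI allI impI)
    fix S T
    assume S: "S \<subseteq> q ` topspace X \<and> openin X {x \<in> topspace X. q x \<in> S}"
      and T: "T \<subseteq> q ` topspace X \<and> openin X {x \<in> topspace X. q x \<in> T}"
    show "S \<inter> T \<subseteq> q ` topspace X" using S by blast
    have "{x \<in> topspace X. q x \<in> S \<inter> T} =
      {x \<in> topspace X. q x \<in> S} \<inter> {x \<in> topspace X. q x \<in> T}" by blast
    then show "openin X {x \<in> topspace X. q x \<in> S \<inter> T}" using S T by auto
  next
    fix K
    assume K: "\<forall>S\<in>K. S \<subseteq> q ` topspace X \<and> openin X {x \<in> topspace X. q x \<in> S}"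
    show "\<Union>K \<subseteq> q ` topspace X" using K by blast
    have "{x \<in> topspace X. q x \<in> \<Union>K} = (\<Union>S\<in>K. {x \<in> topspace X. q x \<in> S})" by blast
    then show "openin X {x \<in> topspace X. q x \<in> \<Union>K}" using K by auto
  qed
  then show ?thesis
    unfolding quotient_topology_def by (simp add: topology_inverse')
qed

lemma topspace_quotient_topology: "topspace (quotient_topology X q) = q ` topspace X"
proof
  show "topspace (quotient_topology X q) \<subseteq> q ` topspace X"
    using openin_quotient_topology openin_topspace by metis
  have "{x \<in> topspace X. q x \<in> q ` topspace X} = topspace X" by blast
  then have "openin (quotient_topology X q) (q ` topspace X)"
    by (simp add: openin_quotient_topology)
  then show "q ` topspace X \<subseteq> topspace (quotient_topology X q)"
    by (rule openin_subset)
qed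

lemma quotient_map_quotient_topology: "quotient_map X (quotient_topology X q) q"
  by (auto simp: quotient_map_def topspace_quotient_topology openin_quotient_topology)


section \<open>Function spaces with the topology of pointwise convergence\<close>

text \<open>
  Points of the product topology on \<open>I\<close> are the functions that are \<open>undefined\<close> outside \<open>I\<close>,
  hence the \<open>\<lambda>x\<in>I\<close> in the operations.
\<close>

definition pointwise :: "'a set \<Rightarrow> ('a \<Rightarrow> real) set \<Rightarrow> ('a \<Rightarrow> real) top_vec" where
  "pointwise I S =
     \<lparr>topo = subtopology (product_topology (\<lambda>_. euclideanreal) I) S,
      vadd = (\<lambda>f g. \<lambda>x\<in>I. f x + g x),
      vscale = (\<lambda>c f. \<lambda>x\<in>I. c * f x)\<rparr>"

definition Cp :: "'a topology \<Rightarrow> ('a \<Rightarrow> real) top_vec" where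
  "Cp X = pointwise (topspace X) {f. continuous_map X euclideanreal f}"

lemma vecs_Cp:
  "vecs (Cp X) = {f \<in> extensional (topspace X). continuous_map X euclideanreal f}"
  by (auto simp: Cp_def pointwise_def PiE_def)

text \<open>An element \<open>\<mu>\<close> of the dual of \<open>Cp X\<close> is represented by its coefficients: \<open>\<mu> x\<close> is the
  coefficient of the Dirac measure at \<open>x\<close>.\<close>

definition Cp_dual :: "'a topology \<Rightarrow> ('a \<Rightarrow> real) set" where
  "Cp_dual X = {\<mu>. finite {x. \<mu> x \<noteq> 0} \<and> {x. \<mu> x \<noteq> 0} \<subseteq> topspace X}"

definition dual_norm :: "('a \<Rightarrow> real) \<Rightarrow> real" where
  "dual_norm \<mu> = (\<Sum>x | \<mu> x \<noteq> 0. \<bar>\<mu> x\<bar>)"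

definition dual_apply :: "('a \<Rightarrow> real) \<Rightarrow> ('a \<Rightarrow> real) \<Rightarrow> real" where
  "dual_apply \<mu> f = (\<Sum>x | \<mu> x \<noteq> 0. \<mu> x * f x)"

definition Josefson_Nissenzweig :: "'a topology \<Rightarrow> bool" where
  "Josefson_Nissenzweig X \<longleftrightarrow>
     (\<exists>\<nu>::nat \<Rightarrow> 'a \<Rightarrow> real.
        (\<forall>n. \<nu> n \<in> Cp_dual X \<and> dual_norm (\<nu> n) = 1) \<and>
        (\<forall>f\<in>vecs (Cp X). (\<lambda>n. dual_apply (\<nu> n) f) \<longlonglongrightarrow> 0))"


section \<open>Sequence spaces\<close>

abbreviation seq_space :: "(nat \<Rightarrow> real) set \<Rightarrow> (nat \<Rightarrow> real) top_vec" where
  "seq_space E \<equiv> pointwise UNIV E"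

lemma vecs_seq_space: "vecs (seq_space E) = E"
  by (simp add: pointwise_def)

definition c0 :: "(nat \<Rightarrow> real) set" where
  "c0 = {x. x \<longlonglongrightarrow> 0}"

text \<open>
  Sequences are indexed from 0, so the \<open>n\<close>-th term (\<open>n \<ge> 0\<close>) is the \<open>(n+1)\<close>-st term in the usual
  indexing from 1, and the usual condition \<open>card F < n + 1\<close> reads \<open>card F \<le> n\<close>.
\<close>

definition decreasing_rearrangement :: "(nat \<Rightarrow> real) \<Rightarrow> nat \<Rightarrow> real" where
  "decreasing_rearrangement x n =
     (INF F \<in> {F. finite F \<and> card F \<le> n}. SUP k \<in> - F. \<bar>x k\<bar>)"

definition symmetric_sequence_ideal :: "(nat \<Rightarrow> real) set \<Rightarrow> bool" where
  "symmetric_sequence_ideal E \<longleftrightarrow>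
     linear_subspace (seq_space UNIV) E \<and> E \<subseteq> c0 \<and>
     (\<forall>x\<in>E. \<forall>y\<in>c0.
        (\<forall>n. decreasing_rearrangement y n \<le> decreasing_rearrangement x n) \<longrightarrow> y \<in> E)"

end

theory Submission
  imports Defs
begin

text \<open>
  The implications from (iii) and (iv) to (i) only compose maps: a projection, respectively a
  quotient map, followed by an isomorphism onto \<open>(c0)\<^sub>p\<close>. The substance is a gliding hump.

  Let \<open>\<nu>\<close> be a sequence of finitely supported measures of norm 1 that tends to 0 pointwise on
  \<open>C(X)\<close>. The measures cannot stay on a finite set \<open>F\<close>: only finitely many sign patterns are
  possible on \<open>F\<close>, each is the restriction of one continuous function, and testing against these
  functions shows that eventually at least 3/8 of the mass lies off \<open>F\<close>. Hence one finds many
  pairwise disjoint closed sets, each carrying a definite part of some \<open>\<nu> n\<close>; as every measure has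
  mass 1, a pigeonhole argument picks one of these sets that is nearly null for infinitely many of the
  remaining measures. Iterating gives a subsequence \<open>\<nu> (r k)\<close> and disjointly supported bump
  functions \<open>h k\<close> whose matrix of values \<open>\<nu> (r k) (h j)\<close> is lower triangular, has diagonal
  entries at least 1/4 and off-diagonal row sums at most 1/8 (\<open>triangular_bump_system\<close>).
  Forward substitution inverts such a matrix without leaving the null sequences. So
  \<open>c \<mapsto> \<Sum>k. c k * h k\<close> has a left inverse that is built from the \<open>\<nu> (r k)\<close>, and both maps are
  continuous for the pointwise topologies: at a point only one bump is alive, and the \<open>k\<close>-th
  coordinate of the left inverse involves only finitely many measures
  (\<open>JN_sequence_retraction\<close>). A retraction onto \<open>(c0)\<^sub>p\<close> yields (iii) and (iv).

  For (i) \<open>\<Longrightarrow>\<close> (ii), the coordinates of a surjection onto \<open>E\<^sub>p\<close> are finitely supported measures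
  \<open>\<mu> n\<close> that tend to 0 pointwise. Suppose that for some continuous weight \<open>g\<close> the norms of
  \<open>g \<mu> n\<close> do not tend to 0. Then a normalized subsequence of \<open>g \<mu> n\<close> witnesses the
  Josefson--Nissenzweig property. By the retraction, every null sequence occurs along a subsequence of
  coordinates of some element of \<open>E\<close>, and the symmetry of \<open>E\<close> turns this into \<open>c0 \<subseteq> E\<close>.

  Such a weight exists (\<open>surjection_weight_exists\<close>). Otherwise every continuous function is bounded
  on the union of the supports of the \<open>\<mu> n\<close>, so that every \<open>y \<in> E\<close> is \<open>O(\<parallel>\<mu> n\<parallel>)\<close>, where
  \<open>\<parallel>\<mu> n\<parallel>\<close> tends to 0. But \<open>E\<close> contains a sequence without zero entries, the image of a
  fast convergent series of functions whose images are the unit vectors, and its entries can be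
  moved to positions where \<open>\<parallel>\<mu> n\<parallel>\<close> is much smaller still.
\<close>

section \<open>Finitely supported measures\<close>

definition mass :: "('a \<Rightarrow> real) \<Rightarrow> 'a set \<Rightarrow> real" where
  "mass \<mu> A = (\<Sum>x\<in>{x. \<mu> x \<noteq> 0} \<inter> A. \<bar>\<mu> x\<bar>)"

lemma mass_mono:
  assumes "\<mu> \<in> Cp_dual X" "A \<subseteq> B"
  shows "mass \<mu> A \<le> mass \<mu> B"
  unfolding mass_def using assms by (intro sum_mono2) (auto simp: Cp_dual_def)

lemma mass_le_norm: "\<mu> \<in> Cp_dual X \<Longrightarrow> mass \<mu> A \<le> dual_norm \<mu>"
  unfolding mass_def dual_norm_def by (intro sum_mono2) (auto simp: Cp_dual_def)

lemma mass_compl: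
  assumes "\<mu> \<in> Cp_dual X"
  shows "mass \<mu> A + mass \<mu> (- A) = dual_norm \<mu>"
proof -
  have "mass \<mu> A + mass \<mu> (- A)
      = (\<Sum>x\<in>({x. \<mu> x \<noteq> 0} \<inter> A) \<union> ({x. \<mu> x \<noteq> 0} \<inter> - A). \<bar>\<mu> x\<bar>)"
    unfolding mass_def using assms by (intro sum.union_disjoint [symmetric]) (auto simp: Cp_dual_def)
  also have "({x. \<mu> x \<noteq> 0} \<inter> A) \<union> ({x. \<mu> x \<noteq> 0} \<inter> - A) = {x. \<mu> x \<noteq> 0}" by blast
  finally show ?thesis by (simp add: dual_norm_def)
qed

lemma mass_Un_le:
  assumes "\<mu> \<in> Cp_dual X"
  shows "mass \<mu> (A \<union> B) \<le> mass \<mu> A + mass \<mu> B"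
proof -
  have fin: "finite {x. \<mu> x \<noteq> 0}" using assms by (simp add: Cp_dual_def)
  have "mass \<mu> (A \<union> B) = (\<Sum>x\<in>({x. \<mu> x \<noteq> 0} \<inter> A) \<union> ({x. \<mu> x \<noteq> 0} \<inter> B). \<bar>\<mu> x\<bar>)"
    unfolding mass_def by (rule sum.cong) auto
  also have "\<dots> \<le> mass \<mu> A + mass \<mu> B"
    unfolding mass_def using fin by (subst sum_Un) (auto simp: sum_nonneg)
  finally show ?thesis .
qed

lemma sum_mass_disjoint:
  assumes "\<mu> \<in> Cp_dual X" "finite I" "disjoint_family_on C I"
  shows "(\<Sum>i\<in>I. mass \<mu> (C i)) \<le> dual_norm \<mu>"
proof -
  have fin: "finite {x. \<mu> x \<noteq> 0}" using assms by (simp add: Cp_dual_def)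
  have "(\<Sum>i\<in>I. mass \<mu> (C i)) = (\<Sum>x\<in>(\<Union>i\<in>I. {x. \<mu> x \<noteq> 0} \<inter> C i). \<bar>\<mu> x\<bar>)"
    unfolding mass_def using fin assms(2,3)
    by (intro sum.UNION_disjoint [symmetric]) (auto simp: disjoint_family_on_def)
  also have "\<dots> = mass \<mu> (\<Union>i\<in>I. C i)"
    unfolding mass_def by (rule sum.cong) auto
  also have "\<dots> \<le> dual_norm \<mu>"
    using assms(1) by (rule mass_le_norm)
  finally show ?thesis .
qed

lemma dual_apply_superset:
  assumes "finite F" "{x. \<mu> x \<noteq> 0} \<subseteq> F"
  shows "dual_apply \<mu> f = (\<Sum>x\<in>F. \<mu> x * f x)"
  unfolding dual_apply_def using assms by (intro sum.mono_neutral_left) auto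

lemma dual_apply_cong:
  assumes "\<mu> \<in> Cp_dual X" "\<And>x. x \<in> topspace X \<Longrightarrow> f x = g x"
  shows "dual_apply \<mu> f = dual_apply \<mu> g"
  unfolding dual_apply_def using assms by (intro sum.cong) (auto simp: Cp_dual_def)

lemma dual_apply_restrict:
  assumes "\<mu> \<in> Cp_dual X"
  shows "dual_apply \<mu> (restrict f (topspace X)) = dual_apply \<mu> f"
  using assms by (rule dual_apply_cong) simp

lemma dual_apply_add: "dual_apply \<mu> (\<lambda>x. f x + g x) = dual_apply \<mu> f + dual_apply \<mu> g"
  by (simp add: dual_apply_def distrib_left sum.distrib)

lemma dual_apply_scale: "dual_apply \<mu> (\<lambda>x. c * f x) = c * dual_apply \<mu> f"
  by (simp add: dual_apply_def sum_distrib_left algebra_simps)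

lemma dual_apply_sums:
  assumes "\<mu> \<in> Cp_dual X" "\<And>x. x \<in> topspace X \<Longrightarrow> (\<lambda>k. g k x) sums G x"
  shows "(\<lambda>k. dual_apply \<mu> (g k)) sums dual_apply \<mu> G"
  unfolding dual_apply_def using assms
  by (intro sums_sum sums_mult) (auto simp: Cp_dual_def)

lemma abs_dual_apply_le_mass:
  assumes \<mu>: "\<mu> \<in> Cp_dual X"
    and f: "\<And>x. x \<in> topspace X \<Longrightarrow> \<bar>f x\<bar> \<le> 1" "\<And>x. x \<in> topspace X - A \<Longrightarrow> f x = 0"
  shows "\<bar>dual_apply \<mu> f\<bar> \<le> mass \<mu> A"
proof -
  have fin: "finite {x. \<mu> x \<noteq> 0}" and sub: "{x. \<mu> x \<noteq> 0} \<subseteq> topspace X"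
    using \<mu> by (auto simp: Cp_dual_def)
  have "dual_apply \<mu> f = (\<Sum>x\<in>{x. \<mu> x \<noteq> 0} \<inter> A. \<mu> x * f x)"
    unfolding dual_apply_def using fin sub f(2) by (intro sum.mono_neutral_right) auto
  also have "\<bar>\<dots>\<bar> \<le> (\<Sum>x\<in>{x. \<mu> x \<noteq> 0} \<inter> A. \<bar>\<mu> x * f x\<bar>)" by (rule sum_abs)
  also have "\<dots> \<le> mass \<mu> A"
    unfolding mass_def using sub f(1) by (intro sum_mono) (auto simp: abs_mult intro!: mult_left_le)
  finally show ?thesis .
qed

section \<open>Continuous functions on Tychonoff spaces\<close>

lemma continuous_map_real_compose:
  assumes "continuous_map X euclideanreal f" "continuous_on UNIV \<phi>"
  shows "continuous_map X euclideanreal (\<lambda>x. \<phi> (f x) :: real)"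
  using continuous_map_compose[OF assms(1), of euclideanreal \<phi>] assms(2)
  by (simp add: o_def)

text \<open>
  A finite linear combination of functions that are 1 at one point of \<open>P\<close> and vanish on \<open>D\<close>
  and at the other points of \<open>P\<close>, truncated at height \<open>B\<close>.
\<close>

lemma Tychonoff_interpolation:
  fixes v :: "'a \<Rightarrow> real"
  assumes cr: "completely_regular_space X" and "Hausdorff_space X"
    and D: "closedin X D" and P: "finite P" "P \<subseteq> topspace X"
    and v: "\<And>x. x \<in> P - D \<Longrightarrow> \<bar>v x\<bar> \<le> B" and B: "0 \<le> B"
  obtains f where "continuous_map X euclideanreal f" "\<And>x. x \<in> P - D \<Longrightarrow> f x = v x"
    "\<And>x. x \<in> D \<Longrightarrow> f x = 0" "\<And>x. \<bar>f x\<bar> \<le> B"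
proof -
  have "\<exists>\<phi>. continuous_map X euclideanreal \<phi> \<and> \<phi> p = (0::real) \<and> \<phi> ` (D \<union> (P - {p})) \<subseteq> {1}"
    if p: "p \<in> P - D" for p
  proof -
    have "closedin X (D \<union> (P - {p}))"
      using D P \<open>Hausdorff_space X\<close>
      by (intro closedin_Un) (auto intro!: closedin_Hausdorff_finite)
    moreover have "p \<in> topspace X - (D \<union> (P - {p}))" using p P by auto
    ultimately show ?thesis
      using cr unfolding completely_regular_space_def continuous_map_in_subtopology by metis
  qed
  then have "\<exists>\<phi>. \<forall>p\<in>P - D. continuous_map X euclideanreal (\<phi> p) \<and> \<phi> p p = (0::real)
      \<and> \<phi> p ` (D \<union> (P - {p})) \<subseteq> {1}"
    by (intro bchoice) blast
  then obtain \<phi> where \<phi>: "\<And>p. p \<in> P - D \<Longrightarrow> continuous_map X euclideanreal (\<phi> p)"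
    "\<And>p. p \<in> P - D \<Longrightarrow> \<phi> p p = (0::real)"
    "\<And>p x. p \<in> P - D \<Longrightarrow> x \<in> D \<union> (P - {p}) \<Longrightarrow> \<phi> p x = 1"
    unfolding image_subset_iff singleton_iff by blast
  define g where "g x = (\<Sum>p\<in>P - D. v p * (1 - \<phi> p x))" for x
  have g: "continuous_map X euclideanreal g"
    unfolding g_def using P \<phi>(1) by (intro continuous_intros) auto
  have gv: "g x = v x" if x: "x \<in> P - D" for x
  proof -
    have "g x = (\<Sum>p\<in>P - D. if p = x then v x else 0)"
      unfolding g_def using x \<phi>(2,3) by (intro sum.cong) auto
    then show ?thesis using x P by simp
  qed
  have g0: "g x = 0" if x: "x \<in> D" for x
    unfolding g_def using x \<phi>(3) by (intro sum.neutral) auto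
  show ?thesis
  proof
    show "continuous_map X euclideanreal (\<lambda>x. max (- B) (min B (g x)))"
      by (rule continuous_map_real_compose[OF g]) (intro continuous_intros)
    show "max (- B) (min B (g x)) = v x" if "x \<in> P - D" for x
      using gv[OF that] v[OF that] by auto
  qed (use g0 B in auto)
qed

lemma continuous_map_uniform_suminf:
  fixes g :: "nat \<Rightarrow> 'a \<Rightarrow> real"
  assumes g: "\<And>k. continuous_map X euclideanreal (g k)"
    and lim: "\<And>e. 0 < e \<Longrightarrow>
      \<forall>\<^sub>F N in sequentially. \<forall>x\<in>topspace X. \<bar>G x - (\<Sum>k<N. g k x)\<bar> < e"
  shows "continuous_map X euclideanreal G"
proof -
  have "continuous_map X Met_TC.mtopology G"
  proof (rule Met_TC.continuous_map_uniform_limit)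
    show "\<forall>\<^sub>F N in sequentially. continuous_map X Met_TC.mtopology (\<lambda>x. \<Sum>k<N. g k x)"
      using g by (intro always_eventually allI) (simp add: continuous_map_sum)
    fix e :: real assume "0 < e"
    from lim[OF this]
    show "\<forall>\<^sub>F N in sequentially. \<forall>x\<in>topspace X. G x \<in> UNIV \<and> dist (\<Sum>k<N. g k x) (G x) < e"
      by eventually_elim (auto simp: dist_real_def abs_minus_commute)
  qed auto
  then show ?thesis by simp
qed

section \<open>Null sequences of measures\<close>

text \<open>
  Testing a measure against its own signs recovers its total variation.
\<close>

lemma dual_apply_eq_mass:
  assumes "\<mu> \<in> Cp_dual X"
    and "\<And>x. \<mu> x \<noteq> 0 \<Longrightarrow> x \<in> G \<Longrightarrow> f x = sgn (\<mu> x)"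
    and "\<And>x. \<mu> x \<noteq> 0 \<Longrightarrow> x \<notin> G \<Longrightarrow> f x = 0"
  shows "dual_apply \<mu> f = mass \<mu> G"
proof -
  have "dual_apply \<mu> f = (\<Sum>x\<in>{x. \<mu> x \<noteq> 0} \<inter> G. \<mu> x * f x)"
    unfolding dual_apply_def using assms by (intro sum.mono_neutral_right) (auto simp: Cp_dual_def)
  also have "\<dots> = mass \<mu> G"
    unfolding mass_def using assms(2) by (intro sum.cong) (auto simp: abs_sgn)
  finally show ?thesis .
qed

text \<open>
  The sequences that witness the Josefson--Nissenzweig property. The test functions are all continuous
  functions, not only the extensional ones: a measure on \<open>X\<close> does not see values outside \<open>X\<close>.
\<close>

definition JN_sequence :: "'a topology \<Rightarrow> (nat \<Rightarrow> 'a \<Rightarrow> real) \<Rightarrow> bool" where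
  "JN_sequence X \<nu> \<longleftrightarrow> (\<forall>n. \<nu> n \<in> Cp_dual X \<and> dual_norm (\<nu> n) = 1) \<and>
     (\<forall>f. continuous_map X euclideanreal f \<longrightarrow> (\<lambda>n. dual_apply (\<nu> n) f) \<longlonglongrightarrow> 0)"

lemma JN_sequenceD:
  assumes "JN_sequence X \<nu>"
  shows "\<nu> n \<in> Cp_dual X" "dual_norm (\<nu> n) = 1"
    "continuous_map X euclideanreal f \<Longrightarrow> (\<lambda>n. dual_apply (\<nu> n) f) \<longlonglongrightarrow> 0"
  using assms by (auto simp: JN_sequence_def)

text \<open>
  On \<open>F\<close> the measure \<open>\<nu> n\<close> has one of finitely many sign patterns \<open>s\<close>. For a continuous
  extension \<open>\<phi> s\<close> of the pattern with values in \<open>[-1, 1]\<close>, the value of \<open>\<nu> n\<close> at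
  \<open>\<phi> s\<close> is at least the mass on \<open>F\<close> minus the mass off \<open>F\<close>. As it eventually drops below 1/4
  for all patterns at once and the two masses add up to 1, the mass off \<open>F\<close> is at least 3/8. The
  bound does not depend on \<open>F\<close>, which makes it usable in an induction.
\<close>

lemma mass_escapes_finite_sets:
  fixes \<nu> :: "nat \<Rightarrow> 'a \<Rightarrow> real"
  assumes X: "completely_regular_space X" "Hausdorff_space X"
    and JN: "JN_sequence X \<nu>"
    and F: "finite F" "F \<subseteq> topspace X"
  shows "\<forall>\<^sub>F n in sequentially. 3 / 8 \<le> mass (\<nu> n) (- F)"
proof -
  note \<nu> = JN_sequenceD(1)[OF JN] and norm = JN_sequenceD(2)[OF JN] and null = JN_sequenceD(3)[OF JN]
  define S where "S = F \<rightarrow>\<^sub>E {-1, 1::real}"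
  have "finite S" unfolding S_def using F by (simp add: finite_PiE)
  have "\<exists>f. continuous_map X euclideanreal f \<and> (\<forall>x\<in>F. f x = s x) \<and> (\<forall>x. \<bar>f x\<bar> \<le> 1)"
    if s: "s \<in> S" for s
  proof -
    have "\<bar>s x\<bar> \<le> 1" if "x \<in> F - {}" for x
      using s that by (auto simp: S_def dest: PiE_mem)
    then obtain f where "continuous_map X euclideanreal f" "\<And>x. x \<in> F - {} \<Longrightarrow> f x = s x"
        "\<And>x. \<bar>f x\<bar> \<le> 1"
      by (rule Tychonoff_interpolation[OF X closedin_empty F]) auto
    then show ?thesis by auto
  qed
  then have "\<exists>\<phi>. \<forall>s\<in>S. continuous_map X euclideanreal (\<phi> s) \<and> (\<forall>x\<in>F. \<phi> s x = s x) \<and> (\<forall>x. \<bar>\<phi> s x\<bar> \<le> 1)"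
    by (intro bchoice) blast
  then obtain \<phi> where \<phi>: "\<And>s. s \<in> S \<Longrightarrow> continuous_map X euclideanreal (\<phi> s)"
    "\<And>s x. s \<in> S \<Longrightarrow> x \<in> F \<Longrightarrow> \<phi> s x = s x" "\<And>s x. s \<in> S \<Longrightarrow> \<bar>\<phi> s x\<bar> \<le> 1"
    by blast
  have "\<forall>\<^sub>F n in sequentially. \<bar>dual_apply (\<nu> n) (\<phi> s)\<bar> < 1 / 4" if "s \<in> S" for s
    using tendstoD[OF null[OF \<phi>(1)[OF that]], of "1 / 4"] by (simp add: dist_real_def)
  then have "\<forall>\<^sub>F n in sequentially. \<forall>s\<in>S. \<bar>dual_apply (\<nu> n) (\<phi> s)\<bar> < 1 / 4"
    using \<open>finite S\<close> by (simp add: eventually_ball_finite)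
  then show ?thesis
  proof eventually_elim
    case (elim n)
    define s where "s = restrict (\<lambda>x. if 0 \<le> \<nu> n x then 1 else - 1 :: real) F"
    have s: "s \<in> S" by (auto simp: s_def S_def)
    let ?f = "\<lambda>x. if x \<in> F then \<phi> s x else 0" and ?g = "\<lambda>x. if x \<in> F then 0 else \<phi> s x"
    have "dual_apply (\<nu> n) (\<phi> s) = dual_apply (\<nu> n) (\<lambda>x. ?f x + ?g x)"
      by (rule dual_apply_cong[OF \<nu>]) simp
    also have "\<dots> = dual_apply (\<nu> n) ?f + dual_apply (\<nu> n) ?g" by (rule dual_apply_add)
    also have "dual_apply (\<nu> n) ?f = mass (\<nu> n) F"
    proof (rule dual_apply_eq_mass[OF \<nu>])
      show "?f x = sgn (\<nu> n x)" if "\<nu> n x \<noteq> 0" "x \<in> F" for x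
        using that \<phi>(2)[OF s, of x] by (simp add: s_def sgn_if)
    qed simp
    finally have eq: "dual_apply (\<nu> n) (\<phi> s) = mass (\<nu> n) F + dual_apply (\<nu> n) ?g" .
    have "\<bar>dual_apply (\<nu> n) ?g\<bar> \<le> mass (\<nu> n) (- F)"
      using \<phi>(3)[OF s] by (intro abs_dual_apply_le_mass[OF \<nu>]) auto
    moreover have "mass (\<nu> n) F + mass (\<nu> n) (- F) = 1"
      using mass_compl[OF \<nu>] norm by simp
    moreover have "\<bar>dual_apply (\<nu> n) (\<phi> s)\<bar> < 1 / 4" using elim s by blast
    ultimately show ?case using eq by linarith
  qed
qed

text \<open>
  One step of the gliding hump. Let \<open>D\<close> be the region that is already occupied, and \<open>F\<close> a finite
  set that must be avoided. Since mass escapes from finite sets, there are indices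
  \<open>n 0, n 1, \<dots>\<close> such that each \<open>\<nu> (n i)\<close> has mass at least \<open>3/8 - 1/8\<close> on a finite set
  \<open>S (n i) \<inter> G i\<close> disjoint from \<open>D\<close>, from \<open>F\<close> and from the supports of its predecessors.
  A continuous function \<open>g\<close> with the value \<open>i + 1\<close> on the \<open>i\<close>-th of these sets, and 0 on
  \<open>D \<union> F\<close>, separates the first \<open>K\<close> of them by the disjoint closed sets
  \<open>C i = g -` [i + 2/3, i + 4/3]\<close>. For each \<open>m\<close>, one of the \<open>C i\<close> has mass at most \<open>1/K\<close>
  for \<open>\<nu> m\<close>, so one and the same \<open>C i\<close> works for infinitely many \<open>m\<close>. The bump is a cut-off
  around the level \<open>i + 1\<close> of \<open>g\<close>, multiplied by the signs of \<open>\<nu> (n i)\<close>.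
\<close>

lemma separated_bump:
  fixes \<nu> :: "nat \<Rightarrow> 'a \<Rightarrow> real"
  assumes X: "completely_regular_space X" "Hausdorff_space X"
    and JN: "JN_sequence X \<nu>"
    and F: "finite F" "F \<subseteq> topspace X" and D: "closedin X D"
    and N: "infinite N" "\<forall>m\<in>N. mass (\<nu> m) D \<le> 1 / 8" and "0 < \<delta>"
  obtains n h C N' where "n \<in> N" "p < n" "continuous_map X euclideanreal h" "\<And>x. \<bar>h x\<bar> \<le> 1"
    "closedin X C" "C \<inter> (D \<union> F) = {}" "\<And>x. x \<in> topspace X - C \<Longrightarrow> h x = 0"
    "1 / 4 \<le> dual_apply (\<nu> n) h" "infinite N'" "N' \<subseteq> N" "\<And>m. m \<in> N' \<Longrightarrow> mass (\<nu> m) C \<le> \<delta>"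
proof -
  note \<nu> = JN_sequenceD(1)[OF JN] and norm = JN_sequenceD(2)[OF JN]
  define S where "S m = {x. \<nu> m x \<noteq> 0}" for m
  have S: "finite (S m)" "S m \<subseteq> topspace X" for m
    using \<nu>[of m] by (auto simp: S_def Cp_dual_def)
  have "\<exists>n :: nat \<Rightarrow> nat. \<forall>i. n i \<in> N \<and> p < n i \<and> 3 / 8 \<le> mass (\<nu> (n i)) (- (F \<union> (\<Union>j<i. S (n j))))"
  proof (rule dependent_wellorder_choice[where P = "\<lambda>n i r. r \<in> N \<and> p < r \<and>
      3 / 8 \<le> mass (\<nu> r) (- (F \<union> (\<Union>j<i. S (n j))))"])
    fix r i and n n' :: "nat \<Rightarrow> nat"
    assume "\<And>j. j < i \<Longrightarrow> n j = n' j"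
    then show "(r \<in> N \<and> p < r \<and> 3 / 8 \<le> mass (\<nu> r) (- (F \<union> (\<Union>j<i. S (n j))))) =
      (r \<in> N \<and> p < r \<and> 3 / 8 \<le> mass (\<nu> r) (- (F \<union> (\<Union>j<i. S (n' j)))))" by simp
  next
    fix i and n :: "nat \<Rightarrow> nat"
    have "\<forall>\<^sub>F m in sequentially. 3 / 8 \<le> mass (\<nu> m) (- (F \<union> (\<Union>j<i. S (n j))))"
      using S F by (intro mass_escapes_finite_sets[OF X JN]) auto
    then obtain q where "\<And>m. m \<ge> q \<Longrightarrow> 3 / 8 \<le> mass (\<nu> m) (- (F \<union> (\<Union>j<i. S (n j))))"
      by (auto simp: eventually_sequentially)
    moreover obtain m where "m \<in> N" "max p q < m"
      using N(1) by (meson infinite_nat_iff_unbounded)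
    ultimately show "\<exists>r. r \<in> N \<and> p < r \<and> 3 / 8 \<le> mass (\<nu> r) (- (F \<union> (\<Union>j<i. S (n j))))"
      by (intro exI[of _ m]) auto
  qed
  then obtain n :: "nat \<Rightarrow> nat" where n: "\<And>i. n i \<in> N" "\<And>i. p < n i"
    "\<And>i. 3 / 8 \<le> mass (\<nu> (n i)) (- (F \<union> (\<Union>j<i. S (n j))))" by blast
  define G where "G i = - (F \<union> (\<Union>j<i. S (n j))) - D" for i
  have massG: "1 / 4 \<le> mass (\<nu> (n i)) (G i)" for i
  proof -
    have "mass (\<nu> (n i)) (- (F \<union> (\<Union>j<i. S (n j)))) \<le> mass (\<nu> (n i)) (G i \<union> D)"
      by (rule mass_mono[OF \<nu>]) (auto simp: G_def)
    also have "\<dots> \<le> mass (\<nu> (n i)) (G i) + mass (\<nu> (n i)) D" by (rule mass_Un_le[OF \<nu>])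
    finally show ?thesis using n(1,3)[of i] N(2) by fastforce
  qed
  have uniq: "i = j" if "x \<in> S (n i) \<inter> G i" "x \<in> S (n j) \<inter> G j" for x i j
  proof (rule linorder_cases[of i j])
    assume "i < j" then show ?thesis using that by (auto simp: G_def)
  next
    assume "j < i" then show ?thesis using that by (auto simp: G_def)
  qed
  obtain K :: nat where K: "0 < K" "inverse (real K) < \<delta>"
    using ex_inverse_of_nat_less[OF \<open>0 < \<delta>\<close>] by blast
  \<comment> \<open>The level assigned to a support point; points that belong to no hump get level 0.\<close>
  define v where
    "v x = (if \<exists>i<K. x \<in> S (n i) \<inter> G i then Suc (THE i. x \<in> S (n i) \<inter> G i) else 0)" for x
  have v_in: "v x = Suc i" if "i < K" "x \<in> S (n i) \<inter> G i" for x i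
  proof -
    have "(THE i. x \<in> S (n i) \<inter> G i) = i" using that uniq by (intro the_equality) blast+
    then show ?thesis using that by (auto simp: v_def)
  qed
  have v_notin: "v x \<noteq> Suc i" if "x \<notin> S (n i) \<inter> G i" for x i
  proof
    assume eq: "v x = Suc i"
    then obtain j where j: "j < K" "x \<in> S (n j) \<inter> G j" by (auto simp: v_def split: if_splits)
    then have "j = i" using v_in[OF j] eq by simp
    then show False using j that by blast
  qed
  have v_le: "v x \<le> K" for x
  proof (cases "\<exists>i<K. x \<in> S (n i) \<inter> G i")
    case True then show ?thesis using v_in by fastforce
  next
    case False then show ?thesis by (auto simp: v_def)
  qed
  have v_F: "v x = 0" if "x \<in> F" for x
    using that by (auto simp: v_def G_def)
  define P where "P = F \<union> (\<Union>i<K. S (n i))"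
  have P: "finite P" "P \<subseteq> topspace X" using F S by (auto simp: P_def)
  obtain g where g: "continuous_map X euclideanreal g" "\<And>x. x \<in> P - D \<Longrightarrow> g x = real (v x)"
    "\<And>x. x \<in> D \<Longrightarrow> g x = 0"
    by (rule Tychonoff_interpolation[OF X D P, of "\<lambda>x. real (v x)" "real K"]) (use v_le in auto)
  define C where "C i = {x \<in> topspace X. g x \<in> {real (Suc i) - 1/3 .. real (Suc i) + 1/3}}" for i
  have C: "closedin X (C i)" for i
    unfolding C_def by (rule closedin_continuous_map_preimage[OF g(1)]) (simp add: closed_closedin [symmetric])
  have CDF: "C i \<inter> (D \<union> F) = {}" for i
  proof -
    have "g x = 0" if "x \<in> D \<union> F" for x
      using that g(2)[of x] g(3)[of x] v_F[of x] by (cases "x \<in> D") (auto simp: P_def)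
    then show ?thesis by (auto simp: C_def)
  qed
  have disj: "disjoint_family_on C {..<K}"
  proof -
    have "i = j" if "x \<in> C i" "x \<in> C j" for x i j
    proof -
      have "real (Suc i) < real (Suc j) + 1" "real (Suc j) < real (Suc i) + 1"
        using that by (auto simp: C_def)
      then show ?thesis by linarith
    qed
    then show ?thesis by (auto simp: disjoint_family_on_def)
  qed
  \<comment> \<open>Otherwise the disjoint sets \<open>C i\<close> would carry more than \<open>K * inverse K = 1\<close> in total.\<close>
  have "\<exists>i<K. mass (\<nu> m) (C i) \<le> \<delta>" for m
  proof (rule ccontr)
    assume "\<not> ?thesis"
    then have "(\<Sum>i<K. inverse (real K)) < (\<Sum>i<K. mass (\<nu> m) (C i))"
      using K by (intro sum_strict_mono) (auto simp: not_le intro: less_trans)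
    also have "\<dots> \<le> 1" using sum_mass_disjoint[OF \<nu> _ disj] norm by (metis finite_lessThan)
    finally show False using K by simp
  qed
  then have "N \<subseteq> (\<Union>i<K. {m \<in> N. mass (\<nu> m) (C i) \<le> \<delta>})" by auto
  then have "infinite (\<Union>i<K. {m \<in> N. mass (\<nu> m) (C i) \<le> \<delta>})"
    using N(1) by (rule infinite_super)
  then obtain i where i: "i < K" "infinite {m \<in> N. mass (\<nu> m) (C i) \<le> \<delta>}"
    by auto
  obtain s where s: "continuous_map X euclideanreal s"
      "\<And>x. x \<in> S (n i) - {} \<Longrightarrow> s x = sgn (\<nu> (n i) x)" "\<And>x. \<bar>s x\<bar> \<le> 1"
    by (rule Tychonoff_interpolation[OF X closedin_empty S(1) S(2), of "n i" "\<lambda>x. sgn (\<nu> (n i) x)" 1])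
      (auto simp: abs_sgn_eq)
  define b where "b t = max 0 (1 - 3 * \<bar>t - real (Suc i)\<bar>)" for t :: real
  have b: "0 \<le> b t" "b t \<le> 1" for t by (auto simp: b_def)
  define h where "h x = b (g x) * s x" for x
  show ?thesis
  proof
    show "n i \<in> N" "p < n i" using n by auto
    have "continuous_map X euclideanreal (\<lambda>x. b (g x))"
      unfolding b_def by (rule continuous_map_real_compose[OF g(1)]) (intro continuous_intros)
    then show "continuous_map X euclideanreal h"
      unfolding h_def using s(1) by (rule continuous_map_real_mult)
    show "\<bar>h x\<bar> \<le> 1" for x
      using b[of "g x"] s(3)[of x] by (simp add: h_def abs_mult mult_le_one)
    show "h x = 0" if "x \<in> topspace X - C i" for x
      using that by (auto simp: h_def b_def C_def not_le)
    show "1 / 4 \<le> dual_apply (\<nu> (n i)) h"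
    proof -
      have "dual_apply (\<nu> (n i)) h = mass (\<nu> (n i)) (G i)"
      proof (rule dual_apply_eq_mass[OF \<nu>])
        fix x assume "\<nu> (n i) x \<noteq> 0"
        then have x: "x \<in> S (n i)" "x \<in> P" using i by (auto simp: S_def P_def)
        show "h x = sgn (\<nu> (n i) x)" if "x \<in> G i"
          using that x v_in[OF i(1), of x] g(2)[of x] s(2)[of x] by (auto simp: h_def b_def G_def)
        show "h x = 0" if "x \<notin> G i"
        proof (cases "x \<in> D")
          case True
          then show ?thesis using g(3)[of x] by (simp add: h_def b_def)
        next
          case False
          have "v x \<noteq> Suc i" using that by (intro v_notin) blast
          then have "1 \<le> \<bar>real (v x) - real (Suc i)\<bar>" by linarith
          then show ?thesis using False x g(2)[of x] by (simp add: h_def b_def)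
        qed
      qed
      then show ?thesis using massG[of i] by simp
    qed
  qed (use C CDF i in auto)
qed

text \<open>
  Iteration of the previous step, with the state \<open>(N, D, F, q, u)\<close>: the indices that are still
  eligible, the occupied region, the union of the supports used so far, the last chosen index, and the
  last bump. Entries above the diagonal vanish because a new bump avoids the supports of the measures
  chosen before. Entries below the diagonal are small because a later measure has mass at most
  \<open>2\<^sup>-\<^sup>k / 16\<close> on the region of the \<open>k\<close>-th bump; summing these bounds also keeps the mass of all
  eligible measures on \<open>D\<close> below 1/8, as the step requires.
\<close>

lemma triangular_bump_system:
  fixes \<nu> :: "nat \<Rightarrow> 'a \<Rightarrow> real"
  assumes X: "completely_regular_space X" "Hausdorff_space X"
    and JN: "JN_sequence X \<nu>"
  obtains r :: "nat \<Rightarrow> nat" and h :: "nat \<Rightarrow> 'a \<Rightarrow> real"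
  where "strict_mono r" "\<And>k. continuous_map X euclideanreal (h k)"
    "\<And>k x. \<bar>h k x\<bar> \<le> 1" "\<forall>x\<in>topspace X. \<forall>j k. h j x \<noteq> 0 \<longrightarrow> h k x \<noteq> 0 \<longrightarrow> j = k"
    "\<And>j k. k < j \<Longrightarrow> dual_apply (\<nu> (r k)) (h j) = 0"
    "\<And>k. 1 / 4 \<le> dual_apply (\<nu> (r k)) (h k)"
    "\<And>k. (\<Sum>j<k. \<bar>dual_apply (\<nu> (r k)) (h j)\<bar>) \<le> 1 / 8"
proof -
  note \<nu> = JN_sequenceD(1)[OF JN]
  define P :: "nat \<Rightarrow> nat set \<times> 'a set \<times> 'a set \<times> nat \<times> ('a \<Rightarrow> real) \<Rightarrow> bool" where
    "P k = (\<lambda>(N, D, F, q, u). infinite N \<and> closedin X D \<and> finite F \<and> F \<subseteq> topspace X \<and>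
       (\<forall>m\<in>N. mass (\<nu> m) D \<le> (1 / 8) * (1 - (1 / 2) ^ k)))" for k
  define Q :: "nat \<Rightarrow> nat set \<times> 'a set \<times> 'a set \<times> nat \<times> ('a \<Rightarrow> real) \<Rightarrow>
      nat set \<times> 'a set \<times> 'a set \<times> nat \<times> ('a \<Rightarrow> real) \<Rightarrow> bool" where
    "Q k = (\<lambda>(N, D, F, q, u) (N', D', F', q', u'). q' \<in> N \<and> q < q' \<and> N' \<subseteq> N \<and> D \<subseteq> D' \<and>
       F \<subseteq> F' \<and> {x. \<nu> q' x \<noteq> 0} \<subseteq> F' \<and> continuous_map X euclideanreal u' \<and> (\<forall>x. \<bar>u' x\<bar> \<le> 1) \<and>
       (\<forall>x\<in>D \<union> F. x \<in> topspace X \<longrightarrow> u' x = 0) \<and> (\<forall>x\<in>topspace X - D'. u' x = 0) \<and>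
       1 / 4 \<le> dual_apply (\<nu> q') u' \<and>
       (\<forall>m\<in>N'. \<bar>dual_apply (\<nu> m) u'\<bar> \<le> (1 / 16) * (1 / 2) ^ k))" for k
  have "\<exists>s. \<forall>k. P k (s k) \<and> Q k (s k) (s (Suc k))"
  proof (rule dependent_nat_choice)
    have "P 0 (UNIV, {}, {}, 0, \<lambda>_. 0)" by (simp add: P_def mass_def)
    then show "\<exists>s. P 0 s" ..
  next
    fix s k assume "P k s"
    then obtain N D F q u where s: "s = (N, D, F, q, u)"
      and N: "infinite N" and D: "closedin X D" and F: "finite F" "F \<subseteq> topspace X"
      and mass: "\<And>m. m \<in> N \<Longrightarrow> mass (\<nu> m) D \<le> (1 / 8) * (1 - (1 / 2) ^ k)"
      by (cases s) (auto simp: P_def)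
    have m8: "\<forall>m\<in>N. mass (\<nu> m) D \<le> 1 / 8"
    proof
      show "mass (\<nu> m) D \<le> 1 / 8" if "m \<in> N" for m
        using mass[OF that] by (rule order_trans) simp
    qed
    have "0 < (1 / 16) * (1 / 2 :: real) ^ k" by simp
    then obtain n h C N' where n: "n \<in> N" "q < n" and h: "continuous_map X euclideanreal h"
      "\<And>x. \<bar>h x\<bar> \<le> 1" and C: "closedin X C" "C \<inter> (D \<union> F) = {}"
      "\<And>x. x \<in> topspace X - C \<Longrightarrow> h x = 0" and hn: "1 / 4 \<le> dual_apply (\<nu> n) h"
      and N': "infinite N'" "N' \<subseteq> N" "\<And>m. m \<in> N' \<Longrightarrow> mass (\<nu> m) C \<le> (1 / 16) * (1 / 2) ^ k"
      by (rule separated_bump[OF X JN F D N m8, where p = q]) (rule that)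
    let ?s = "(N', D \<union> C, F \<union> {x. \<nu> n x \<noteq> 0}, n, h)"
    have "mass (\<nu> m) (D \<union> C) \<le> (1 / 8) * (1 - (1 / 2) ^ Suc k)" if "m \<in> N'" for m
    proof -
      have "mass (\<nu> m) (D \<union> C) \<le> mass (\<nu> m) D + mass (\<nu> m) C" by (rule mass_Un_le[OF \<nu>])
      also have "\<dots> \<le> (1 / 8) * (1 - (1 / 2) ^ k) + (1 / 16) * (1 / 2) ^ k"
        using mass[of m] N'(2,3) that by (intro add_mono) auto
      finally show ?thesis by (simp add: field_simps)
    qed
    then have "P (Suc k) ?s"
      using N'(1) D C(1) F \<nu>[of n] by (auto simp: P_def Cp_dual_def)
    moreover have "\<bar>dual_apply (\<nu> m) h\<bar> \<le> (1 / 16) * (1 / 2) ^ k" if "m \<in> N'" for m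
    proof -
      have "\<bar>dual_apply (\<nu> m) h\<bar> \<le> mass (\<nu> m) C"
        by (rule abs_dual_apply_le_mass[OF \<nu>]) (use h(2) C(3) in auto)
      then show ?thesis using N'(3)[OF that] by linarith
    qed
    then have "Q k s ?s"
      unfolding Q_def s using n h C hn N'(2) by auto
    ultimately show "\<exists>s'. P (Suc k) s' \<and> Q k s s'" by blast
  qed
  then obtain s where sP: "\<And>k. P k (s k)" and sQ: "\<And>k. Q k (s k) (s (Suc k))" by blast
  define N where "N k = fst (s k)" for k
  define D where "D k = fst (snd (s k))" for k
  define F where "F k = fst (snd (snd (s k)))" for k
  define q where "q k = fst (snd (snd (snd (s k))))" for k
  define u where "u k = snd (snd (snd (snd (s k))))" for k
  have s: "s k = (N k, D k, F k, q k, u k)" for k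
    by (simp add: N_def D_def F_def q_def u_def)
  note Qs = sQ[unfolded s Q_def prod.case]
  have q: "q (Suc k) \<in> N k" "q k < q (Suc k)" "1 / 4 \<le> dual_apply (\<nu> (q (Suc k))) (u (Suc k))" for k
    using Qs[of k] by simp_all
  have sub: "N (Suc k) \<subseteq> N k" "D k \<subseteq> D (Suc k)" "F k \<subseteq> F (Suc k)"
    "{x. \<nu> (q (Suc k)) x \<noteq> 0} \<subseteq> F (Suc k)" for k
    using Qs[of k] by simp_all
  have u: "continuous_map X euclideanreal (u (Suc k))" "\<bar>u (Suc k) x\<bar> \<le> 1"
    "x \<in> D k \<union> F k \<Longrightarrow> x \<in> topspace X \<Longrightarrow> u (Suc k) x = 0"
    "x \<in> topspace X - D (Suc k) \<Longrightarrow> u (Suc k) x = 0"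
    "m \<in> N (Suc k) \<Longrightarrow> \<bar>dual_apply (\<nu> m) (u (Suc k))\<bar> \<le> (1 / 16) * (1 / 2) ^ k" for k x m
    using Qs[of k] by blast+
  have N_mono: "N k \<subseteq> N j" if "j \<le> k" for j k
    using that by (rule lift_Suc_antimono_le[of N, rotated]) (rule sub)
  have D_mono: "D j \<subseteq> D k" if "j \<le> k" for j k
    using that by (rule lift_Suc_mono_le[of D, rotated]) (rule sub)
  have F_mono: "F j \<subseteq> F k" if "j \<le> k" for j k
    using that by (rule lift_Suc_mono_le[of F, rotated]) (rule sub)
  show ?thesis
  proof (rule that[of "\<lambda>k. q (Suc k)" "\<lambda>k. u (Suc k)"])
    show "strict_mono (\<lambda>k. q (Suc k))"
      using q(2) by (simp add: strict_mono_Suc_iff)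
    show "continuous_map X euclideanreal (u (Suc k))" "\<bar>u (Suc k) x\<bar> \<le> 1" for k x
      by (fact u)+
    show "\<forall>x\<in>topspace X. \<forall>j k. u (Suc j) x \<noteq> 0 \<longrightarrow> u (Suc k) x \<noteq> 0 \<longrightarrow> j = k"
    proof (intro ballI allI impI)
      fix x j k assume x: "x \<in> topspace X" "u (Suc j) x \<noteq> 0" "u (Suc k) x \<noteq> 0"
      have "x \<in> D (Suc j)" "x \<notin> D j" "x \<in> D (Suc k)" "x \<notin> D k"
        using u(3,4) x by blast+
      then show "j = k" using D_mono[of "Suc j" k] D_mono[of "Suc k" j]
        by (meson Suc_leI linorder_neqE_nat subsetD)
    qed
    show "dual_apply (\<nu> (q (Suc k))) (u (Suc j)) = 0" if "k < j" for j k
    proof -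
      have "{x. \<nu> (q (Suc k)) x \<noteq> 0} \<subseteq> F j"
        using sub(4)[of k] F_mono[of "Suc k" j] that by auto
      moreover have "{x. \<nu> (q (Suc k)) x \<noteq> 0} \<subseteq> topspace X"
        using \<nu> by (auto simp: Cp_dual_def)
      ultimately show ?thesis
        unfolding dual_apply_def using u(3)[of _ j] by (intro sum.neutral) auto
    qed
    show "1 / 4 \<le> dual_apply (\<nu> (q (Suc k))) (u (Suc k))" for k
      by (fact q)
    show "(\<Sum>j<k. \<bar>dual_apply (\<nu> (q (Suc k))) (u (Suc j))\<bar>) \<le> 1 / 8" for k
    proof -
      have "(\<Sum>j<k. \<bar>dual_apply (\<nu> (q (Suc k))) (u (Suc j))\<bar>) \<le> (\<Sum>j<k. (1 / 16) * (1 / 2) ^ j)"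
      proof (rule sum_mono)
        fix j assume "j \<in> {..<k}"
        then have "q (Suc k) \<in> N (Suc j)" using q(1)[of k] N_mono[of "Suc j" k] by auto
        then show "\<bar>dual_apply (\<nu> (q (Suc k))) (u (Suc j))\<bar> \<le> (1 / 16) * (1 / 2) ^ j"
          by (rule u(5))
      qed
      also have "\<dots> = (1 / 8) * (1 - (1 / 2) ^ k)"
        by (induction k) (simp_all add: field_simps)
      also have "\<dots> \<le> 1 / 8" by simp
      finally show ?thesis .
    qed
  qed
qed

section \<open>Triangular systems of equations in the space of null sequences\<close>

function forward_substitution :: "(nat \<Rightarrow> nat \<Rightarrow> real) \<Rightarrow> (nat \<Rightarrow> real) \<Rightarrow> nat \<Rightarrow> real" where
  "forward_substitution a y k = (y k - (\<Sum>j<k. a k j * forward_substitution a y j)) / a k k"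
  by pat_completeness auto
termination by (relation "Wellfounded.measure (\<lambda>(a, y, k). k)") auto

declare forward_substitution.simps [simp del]

lemma forward_substitution_solves:
  assumes "a k k \<noteq> 0"
  shows "(\<Sum>j\<le>k. a k j * forward_substitution a y j) = y k"
proof -
  have "(\<Sum>j\<le>k. a k j * forward_substitution a y j)
      = (\<Sum>j<k. a k j * forward_substitution a y j) + a k k * forward_substitution a y k"
    by (simp add: lessThan_Suc_atMost [symmetric])
  also have "\<dots> = y k"
    using assms by (subst forward_substitution.simps[of a y k]) simp
  finally show ?thesis .
qed

lemma forward_substitution_unique:
  assumes "\<And>k. a k k \<noteq> 0" "\<And>k. (\<Sum>j\<le>k. a k j * x j) = y k"
  shows "forward_substitution a y = x"
proof
  fix k show "forward_substitution a y k = x k"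
  proof (induction k rule: less_induct)
    case (less k)
    have "y k = (\<Sum>j<k. a k j * x j) + a k k * x k"
      using assms(2)[of k] by (simp add: lessThan_Suc_atMost [symmetric])
    moreover have "(\<Sum>j<k. a k j * forward_substitution a y j) = (\<Sum>j<k. a k j * x j)"
      using less by (intro sum.cong) auto
    ultimately show ?case
      using assms(1)[of k] by (simp add: forward_substitution.simps[of a y k])
  qed
qed

lemma forward_substitution_add:
  "forward_substitution a (\<lambda>k. y k + z k) k = forward_substitution a y k + forward_substitution a z k"
proof (induction k rule: less_induct)
  case (less k)
  have "(\<Sum>j<k. a k j * forward_substitution a (\<lambda>k. y k + z k) j)
     = (\<Sum>j<k. a k j * forward_substitution a y j) + (\<Sum>j<k. a k j * forward_substitution a z j)"
    unfolding sum.distrib [symmetric] using less by (intro sum.cong) (auto simp: algebra_simps)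
  then show ?case
    by (subst (1 2 3) forward_substitution.simps)
      (simp add: add_divide_distrib [symmetric] diff_divide_distrib [symmetric])
qed

lemma forward_substitution_scale:
  "forward_substitution a (\<lambda>k. c * y k) k = c * forward_substitution a y k"
proof (induction k rule: less_induct)
  case (less k)
  have "(\<Sum>j<k. a k j * forward_substitution a (\<lambda>k. c * y k) j)
     = c * (\<Sum>j<k. a k j * forward_substitution a y j)"
    unfolding sum_distrib_left using less by (intro sum.cong) (auto simp: algebra_simps)
  then show ?case
    by (subst (1 2) forward_substitution.simps) (simp add: right_diff_distrib)
qed

lemma continuous_map_forward_substitution:
  assumes "\<And>k. continuous_map X euclideanreal (\<lambda>f. y f k)"
  shows "continuous_map X euclideanreal (\<lambda>f. forward_substitution a (y f) k)"
proof (induction k rule: less_induct)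
  case (less k)
  have "continuous_map X euclideanreal
      (\<lambda>f. (y f k - (\<Sum>j<k. a k j * forward_substitution a (y f) j)) * inverse (a k k))"
    using assms less by (intro continuous_intros) auto
  then show ?case
    by (subst forward_substitution.simps) (simp add: divide_inverse)
qed

text \<open>
  As \<open>\<bar>1 / a k k\<bar> \<le> 4\<close> and the off-diagonal part of a row sums up to at most 1/8, the solution is
  bounded. If \<open>b\<close> is an eventual bound for it, then so is \<open>3/4 * b\<close>: the right-hand side
  and the finitely many columns before \<open>b\<close> takes effect contribute a null sequence, and the remaining ones contribute at
  most \<open>4 * (1/8) * b\<close>.
\<close>

lemma forward_substitution_null:
  fixes a :: "nat \<Rightarrow> nat \<Rightarrow> real"
  assumes diag: "\<And>k. 1 / 4 \<le> a k k" and off: "\<And>k. (\<Sum>j<k. \<bar>a k j\<bar>) \<le> 1 / 8"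
    and cols: "\<And>j. (\<lambda>k. a k j) \<longlonglongrightarrow> 0" and y: "y \<longlonglongrightarrow> 0"
  shows "forward_substitution a y \<longlonglongrightarrow> 0"
proof -
  let ?x = "forward_substitution a y"
  have rec: "\<bar>?x k\<bar> \<le> 4 * (\<bar>y k\<bar> + (\<Sum>j<k. \<bar>a k j\<bar> * \<bar>?x j\<bar>))" for k
  proof -
    have "\<bar>?x k\<bar> = \<bar>y k - (\<Sum>j<k. a k j * ?x j)\<bar> / a k k"
      using diag[of k] by (subst forward_substitution.simps) (simp add: abs_divide)
    also have "\<dots> \<le> \<bar>y k - (\<Sum>j<k. a k j * ?x j)\<bar> / (1 / 4)"
      using diag[of k] by (intro divide_left_mono) auto
    also have "\<bar>y k - (\<Sum>j<k. a k j * ?x j)\<bar> \<le> \<bar>y k\<bar> + (\<Sum>j<k. \<bar>a k j * ?x j\<bar>)"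
      using sum_abs[of "\<lambda>j. a k j * ?x j" "{..<k}"] by linarith
    finally show ?thesis by (simp add: abs_mult)
  qed
  obtain Y where Y: "0 < Y" "\<And>k. \<bar>y k\<bar> \<le> Y"
    using convergent_imp_Bseq[OF convergentI[OF y]] by (auto simp: Bseq_def)
  have bounded: "\<bar>?x k\<bar> \<le> 8 * Y" for k
  proof (induction k rule: less_induct)
    case (less k)
    have "(\<Sum>j<k. \<bar>a k j\<bar> * \<bar>?x j\<bar>) \<le> (\<Sum>j<k. \<bar>a k j\<bar> * (8 * Y))"
      using less by (intro sum_mono mult_left_mono) auto
    also have "\<dots> = (\<Sum>j<k. \<bar>a k j\<bar>) * (8 * Y)" by (simp add: sum_distrib_right)
    also have "\<dots> \<le> (1 / 8) * (8 * Y)" using off Y by (intro mult_right_mono) auto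
    finally show ?case using rec[of k] Y(2)[of k] by simp
  qed
  have improve: "\<forall>\<^sub>F k in sequentially. \<bar>?x k\<bar> \<le> 3 / 4 * b"
    if b: "0 < b" "\<forall>\<^sub>F k in sequentially. \<bar>?x k\<bar> \<le> b" for b
  proof -
    obtain K where K: "\<And>k. k \<ge> K \<Longrightarrow> \<bar>?x k\<bar> \<le> b"
      using b(2) by (auto simp: eventually_sequentially)
    have "(\<lambda>k. 4 * (\<bar>y k\<bar> + (\<Sum>j<K. \<bar>a k j\<bar> * \<bar>?x j\<bar>))) \<longlonglongrightarrow> 4 * (\<bar>0\<bar> + (\<Sum>j<K. \<bar>0\<bar> * \<bar>?x j\<bar>))"
      by (intro tendsto_intros y cols)
    then have "\<forall>\<^sub>F k in sequentially. 4 * (\<bar>y k\<bar> + (\<Sum>j<K. \<bar>a k j\<bar> * \<bar>?x j\<bar>)) < b / 4"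
      using \<open>0 < b\<close> by (intro order_tendstoD(2)) auto
    then show ?thesis
      using eventually_ge_at_top[of K]
    proof eventually_elim
      case (elim k)
      have "(\<Sum>j<k. \<bar>a k j\<bar> * \<bar>?x j\<bar>) = (\<Sum>j<K. \<bar>a k j\<bar> * \<bar>?x j\<bar>) + (\<Sum>j=K..<k. \<bar>a k j\<bar> * \<bar>?x j\<bar>)"
        using elim(2) by (simp add: lessThan_atLeast0 sum.atLeastLessThan_concat)
      moreover have "(\<Sum>j=K..<k. \<bar>a k j\<bar> * \<bar>?x j\<bar>) \<le> (\<Sum>j=K..<k. \<bar>a k j\<bar> * b)"
        using K by (intro sum_mono mult_left_mono) auto
      moreover have "(\<Sum>j=K..<k. \<bar>a k j\<bar> * b) \<le> (\<Sum>j<k. \<bar>a k j\<bar> * b)"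
        using \<open>0 < b\<close> by (intro sum_mono2) auto
      moreover have "(\<Sum>j<k. \<bar>a k j\<bar> * b) \<le> (1 / 8) * b"
        unfolding sum_distrib_right [symmetric] using off \<open>0 < b\<close> by (intro mult_right_mono) auto
      ultimately have "(\<Sum>j<k. \<bar>a k j\<bar> * \<bar>?x j\<bar>) \<le> (\<Sum>j<K. \<bar>a k j\<bar> * \<bar>?x j\<bar>) + (1 / 8) * b"
        by linarith
      then show ?case using rec[of k] elim(1) by argo
    qed
  qed
  have powers: "\<forall>\<^sub>F k in sequentially. \<bar>?x k\<bar> \<le> (3 / 4) ^ i * (8 * Y)" for i
  proof (induction i)
    case 0 then show ?case using bounded by simp
  next
    case (Suc i)
    show ?case using improve[OF _ Suc] Y(1) by (simp add: mult.assoc)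
  qed
  show ?thesis
  proof (rule tendstoI)
    fix e :: real assume "0 < e"
    have "(\<lambda>i. (3 / 4 :: real) ^ i * (8 * Y)) \<longlonglongrightarrow> 0 * (8 * Y)"
      by (intro tendsto_intros LIMSEQ_realpow_zero) auto
    then have "\<forall>\<^sub>F i in sequentially. (3 / 4 :: real) ^ i * (8 * Y) < e"
      using \<open>0 < e\<close> by (intro order_tendstoD(2)) auto
    then obtain i where "(3 / 4 :: real) ^ i * (8 * Y) < e"
      by (auto simp: eventually_sequentially)
    with powers[of i] show "\<forall>\<^sub>F k in sequentially. dist (?x k) 0 < e"
      by (auto elim!: eventually_mono)
  qed
qed

section \<open>Symmetric sequence ideals\<close>

lemma bdd_above_c0:
  assumes "x \<in> c0"
  shows "bdd_above ((\<lambda>k. \<bar>x k\<bar>) ` A)"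
proof -
  have "Bseq x" using assms by (auto simp: c0_def intro: convergent_imp_Bseq convergentI)
  then show ?thesis by (auto simp: Bseq_def bdd_above_def)
qed

text \<open>
  If the non-zero entries of \<open>y\<close> are dominated by entries of \<open>x\<close> at distinct positions, then
  deleting the positions in \<open>F\<close> from \<open>x\<close> amounts to deleting at most as many positions from \<open>y\<close>.
\<close>

lemma decreasing_rearrangement_le:
  assumes x: "x \<in> c0" and y: "y \<in> c0" and inj: "inj_on \<sigma> {k. y k \<noteq> 0}"
    and le: "\<And>k. y k \<noteq> 0 \<Longrightarrow> \<bar>y k\<bar> \<le> \<bar>x (\<sigma> k)\<bar>"
  shows "decreasing_rearrangement y n \<le> decreasing_rearrangement x n"
  unfolding decreasing_rearrangement_def[of x]
proof (rule cINF_greatest)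
  show "{F. finite F \<and> card F \<le> n} \<noteq> ({} :: nat set set)"
    by (auto intro: exI[of _ "{}"])
  have Compl: "- F \<noteq> {}" if "finite F" for F :: "nat set"
    using that infinite_UNIV_nat by (metis Compl_empty_eq double_compl)
  have SUP_nonneg: "0 \<le> (SUP k\<in>- F. \<bar>z k\<bar>)" if z: "z \<in> c0" and F: "finite F" for z F
  proof -
    obtain k where "k \<in> - F" using Compl[OF F] by blast
    then have "\<bar>z k\<bar> \<le> (SUP k\<in>- F. \<bar>z k\<bar>)" by (intro cSUP_upper bdd_above_c0 z)
    then show ?thesis by linarith
  qed
  fix F :: "nat set" assume "F \<in> {F. finite F \<and> card F \<le> n}"
  then have F: "finite F" "card F \<le> n" by auto
  define F' where "F' = {k. y k \<noteq> 0 \<and> \<sigma> k \<in> F}"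
  have inj': "inj_on \<sigma> F'" and sub: "\<sigma> ` F' \<subseteq> F"
    using inj by (auto simp: F'_def inj_on_def)
  have F': "finite F'" "card F' \<le> n"
    using inj_on_finite[OF inj' sub F(1)] card_inj_on_le[OF inj' sub F(1)] F(2) by auto
  have "decreasing_rearrangement y n \<le> (SUP k\<in>- F'. \<bar>y k\<bar>)"
    unfolding decreasing_rearrangement_def using F'
    by (intro cINF_lower bdd_belowI2[of _ 0] SUP_nonneg y) auto
  also have "\<dots> \<le> (SUP k\<in>- F. \<bar>x k\<bar>)"
  proof (rule cSUP_least[OF Compl[OF F'(1)]])
    fix k assume k: "k \<in> - F'"
    show "\<bar>y k\<bar> \<le> (SUP k\<in>- F. \<bar>x k\<bar>)"
    proof (cases "y k = 0")
      case True
      then show ?thesis using SUP_nonneg[OF x F(1)] by simp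
    next
      case False
      then have "\<sigma> k \<in> - F" using k by (auto simp: F'_def)
      then have "\<bar>x (\<sigma> k)\<bar> \<le> (SUP k\<in>- F. \<bar>x k\<bar>)" by (intro cSUP_upper bdd_above_c0 x)
      then show ?thesis using le[OF False] by linarith
    qed
  qed
  finally show "decreasing_rearrangement y n \<le> (SUP k\<in>- F. \<bar>x k\<bar>)" .
qed

text \<open>
  The form in which symmetry is used: the entries of an element may be moved injectively, decreased,
  and padded with zeros.
\<close>

lemma symmetric_sequence_ideal_memI:
  assumes E: "symmetric_sequence_ideal E" and x: "x \<in> E" and y: "y \<in> c0"
    and "inj_on \<sigma> {k. y k \<noteq> 0}" "\<And>k. y k \<noteq> 0 \<Longrightarrow> \<bar>y k\<bar> \<le> \<bar>x (\<sigma> k)\<bar>"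
  shows "y \<in> E"
proof -
  have "x \<in> c0" using E x by (auto simp: symmetric_sequence_ideal_def)
  then have "\<forall>n. decreasing_rearrangement y n \<le> decreasing_rearrangement x n"
    using assms(3-5) by (auto intro: decreasing_rearrangement_le)
  then show ?thesis using E x y unfolding symmetric_sequence_ideal_def by blast
qed

lemma symmetric_sequence_ideal_scale:
  "symmetric_sequence_ideal E \<Longrightarrow> x \<in> E \<Longrightarrow> (\<lambda>k. c * x k) \<in> E"
  by (simp add: symmetric_sequence_ideal_def linear_subspace_def pointwise_def restrict_def)

lemma symmetric_sequence_ideal_unit:
  assumes E: "symmetric_sequence_ideal E" "E \<noteq> {\<lambda>_. 0}"
  shows "(\<lambda>k. if k = n then 1 else 0) \<in> E"
proof -
  have "E \<noteq> {}" using E by (auto simp: symmetric_sequence_ideal_def linear_subspace_def)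
  then obtain x where "x \<in> E" "x \<noteq> (\<lambda>_. 0)" using E(2) by blast
  then obtain i where x: "x \<in> E" "x i \<noteq> 0" by blast
  show ?thesis
  proof (rule symmetric_sequence_ideal_memI[OF E(1) symmetric_sequence_ideal_scale[OF E(1) x(1)]])
    show "(\<lambda>k. if k = n then 1 else 0) \<in> c0"
      unfolding c0_def using eventually_gt_at_top[of n]
      by (auto intro!: tendsto_eventually elim!: eventually_mono)
    show "inj_on (\<lambda>_. i) {k. (if k = n then 1 else 0 :: real) \<noteq> 0}" by (auto simp: inj_on_def)
    show "\<bar>if k = n then 1 else 0\<bar> \<le> \<bar>inverse (x i) * x i\<bar>" for k using x(2) by simp
  qed
qed

section \<open>The dual of a function space\<close>

lemma topo_Cp: "topo (Cp X) = subtopology (product_topology (\<lambda>_. euclideanreal) (topspace X))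
    {f. continuous_map X euclideanreal f}"
  by (simp add: Cp_def pointwise_def)

lemma vadd_Cp: "vadd (Cp X) f g = restrict (\<lambda>x. f x + g x) (topspace X)"
  by (simp add: Cp_def pointwise_def)

lemma vscale_Cp: "vscale (Cp X) c f = restrict (\<lambda>x. c * f x) (topspace X)"
  by (simp add: Cp_def pointwise_def)

lemma restrict_in_Cp:
  assumes "continuous_map X euclideanreal f"
  shows "restrict f (topspace X) \<in> vecs (Cp X)"
  unfolding vecs_Cp using assms by (auto intro: continuous_map_eq)

lemma vecs_CpD:
  assumes "f \<in> vecs (Cp X)"
  shows "continuous_map X euclideanreal f" "restrict f (topspace X) = f"
  using assms unfolding vecs_Cp by (auto simp: extensional_restrict)

lemma vadd_Cp_closed: "f \<in> vecs (Cp X) \<Longrightarrow> g \<in> vecs (Cp X) \<Longrightarrow> vadd (Cp X) f g \<in> vecs (Cp X)"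
  unfolding vadd_Cp by (intro restrict_in_Cp continuous_intros) (auto dest: vecs_CpD)

lemma vscale_Cp_closed: "f \<in> vecs (Cp X) \<Longrightarrow> vscale (Cp X) c f \<in> vecs (Cp X)"
  unfolding vscale_Cp by (intro restrict_in_Cp continuous_intros) (auto dest: vecs_CpD)

lemma continuous_map_dual_apply:
  assumes "\<mu> \<in> Cp_dual X"
  shows "continuous_map (topo (Cp X)) euclideanreal (dual_apply \<mu>)"
proof -
  have "continuous_map (topo (Cp X)) euclideanreal (\<lambda>f. f x)" if "\<mu> x \<noteq> 0" for x
    unfolding topo_Cp using assms that
    by (intro continuous_map_from_subtopology continuous_map_product_projection)
      (auto simp: Cp_dual_def)
  then have "continuous_map (topo (Cp X)) euclideanreal (\<lambda>f. \<Sum>x | \<mu> x \<noteq> 0. \<mu> x * f x)"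
    using assms by (intro continuous_map_sum continuous_map_real_mult_left) (auto simp: Cp_dual_def)
  then show ?thesis by (simp add: dual_apply_def [abs_def])
qed

text \<open>
  A neighbourhood of 0 on which \<open>\<bar>L\<bar> < 1\<close> restricts only finitely many coordinates. If \<open>f\<close>
  vanishes at these, all multiples of \<open>f\<close> lie in the neighbourhood, which forces \<open>L f = 0\<close>.
\<close>

lemma continuous_functional_determined_by_finite_set:
  assumes scale: "\<And>c f. f \<in> vecs (Cp X) \<Longrightarrow> L (vscale (Cp X) c f) = c * L f"
    and cont: "continuous_map (topo (Cp X)) euclideanreal L"
  obtains F where "finite F" "F \<subseteq> topspace X"
    "\<And>f. f \<in> vecs (Cp X) \<Longrightarrow> \<forall>x\<in>F. f x = 0 \<Longrightarrow> L f = (0::real)"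
proof -
  let ?z = "\<lambda>x\<in>topspace X. 0 :: real"
  have z: "?z \<in> vecs (Cp X)" by (rule restrict_in_Cp) simp
  have "L ?z = 0" using scale[OF z, of 0] by (simp add: vscale_Cp)
  have "openin (topo (Cp X)) {f \<in> vecs (Cp X). L f \<in> {-1<..<1}}"
    using cont by (rule openin_continuous_map_preimage) (simp add: open_openin [symmetric])
  then obtain U where U: "openin (product_topology (\<lambda>_. euclideanreal) (topspace X)) U"
    "{f \<in> vecs (Cp X). L f \<in> {-1<..<1}} = U \<inter> {f. continuous_map X euclideanreal f}"
    unfolding topo_Cp openin_subtopology by blast
  have "?z \<in> {f \<in> vecs (Cp X). L f \<in> {-1<..<1}}" using z \<open>L ?z = 0\<close> by simp
  then have "?z \<in> U" using U(2) by blast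
  then obtain V where V: "finite {x \<in> topspace X. V x \<noteq> topspace euclideanreal}"
    "?z \<in> Pi\<^sub>E (topspace X) V" "Pi\<^sub>E (topspace X) V \<subseteq> U"
    using U(1) unfolding openin_product_topology_alt by metis
  define F where "F = {x \<in> topspace X. V x \<noteq> topspace euclideanreal}"
  show ?thesis
  proof
    show "finite F" "F \<subseteq> topspace X" using V(1) by (auto simp: F_def)
    fix f assume f: "f \<in> vecs (Cp X)" "\<forall>x\<in>F. f x = 0"
    have small: "\<bar>c * L f\<bar> < 1" for c
    proof -
      have "vscale (Cp X) c f \<in> Pi\<^sub>E (topspace X) V"
      proof
        fix x assume x: "x \<in> topspace X"
        show "vscale (Cp X) c f x \<in> V x"
        proof (cases "x \<in> F")
          case True
          then have "vscale (Cp X) c f x = ?z x" using f(2) x by (simp add: vscale_Cp)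
          then show ?thesis using PiE_mem[OF V(2) x] by simp
        next
          case False then show ?thesis using x by (simp add: F_def)
        qed
      qed (simp add: vscale_Cp)
      moreover have "continuous_map X euclideanreal (vscale (Cp X) c f)"
        using vscale_Cp_closed[OF f(1)] by (rule vecs_CpD)
      ultimately have "vscale (Cp X) c f \<in> {f \<in> vecs (Cp X). L f \<in> {-1<..<1}}"
        using U(2) V(3) by blast
      then show ?thesis using scale[OF f(1), of c] by auto
    qed
    show "L f = 0"
    proof (rule ccontr)
      assume "L f \<noteq> 0"
      then show False using small[of "inverse (L f)"] by simp
    qed
  qed
qed

text \<open>
  With \<open>F\<close> as in the previous lemma and functions \<open>h p\<close> dual to the points of \<open>F\<close>, the function
  \<open>f - (\<Sum>p\<in>F. f p * h p)\<close> vanishes on \<open>F\<close>, so \<open>L\<close> is the measure with coefficient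
  \<open>L (h p)\<close> at \<open>p\<close>.
\<close>

lemma functional_representation:
  assumes X: "completely_regular_space X" "Hausdorff_space X"
    and add: "\<And>f g. f \<in> vecs (Cp X) \<Longrightarrow> g \<in> vecs (Cp X) \<Longrightarrow> L (vadd (Cp X) f g) = L f + L g"
    and scale: "\<And>c f. f \<in> vecs (Cp X) \<Longrightarrow> L (vscale (Cp X) c f) = c * L f"
    and cont: "continuous_map (topo (Cp X)) euclideanreal L"
  shows "\<exists>\<mu>\<in>Cp_dual X. \<forall>f\<in>vecs (Cp X). L f = dual_apply \<mu> f"
proof -
  obtain F where F: "finite F" "F \<subseteq> topspace X"
    and F0: "\<And>f. f \<in> vecs (Cp X) \<Longrightarrow> \<forall>x\<in>F. f x = 0 \<Longrightarrow> L f = 0"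
    by (rule continuous_functional_determined_by_finite_set[OF scale cont]) blast+
  have "\<exists>h. continuous_map X euclideanreal h \<and> (\<forall>x\<in>F. h x = (if x = p then 1 else 0 :: real))"
    if "p \<in> F" for p
  proof -
    obtain h where "continuous_map X euclideanreal h"
        "\<And>x. x \<in> F - {} \<Longrightarrow> h x = (if x = p then 1 else 0 :: real)"
      by (rule Tychonoff_interpolation[OF X closedin_empty F,
            where v = "\<lambda>x. if x = p then 1 else 0" and B = 1]) auto
    then show ?thesis by auto
  qed
  then have "\<exists>h. \<forall>p\<in>F. continuous_map X euclideanreal (h p) \<and>
      (\<forall>x\<in>F. h p x = (if x = p then 1 else 0 :: real))"
    by (intro bchoice) blast
  then obtain h where h: "\<And>p. p \<in> F \<Longrightarrow> continuous_map X euclideanreal (h p)"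
    "\<And>p x. p \<in> F \<Longrightarrow> x \<in> F \<Longrightarrow> h p x = (if x = p then 1 else 0 :: real)"
    by blast
  define e where "e p = restrict (h p) (topspace X)" for p
  have e: "e p \<in> vecs (Cp X)" if "p \<in> F" for p
    unfolding e_def by (rule restrict_in_Cp[OF h(1)[OF that]])
  have comb: "restrict (\<lambda>x. \<Sum>p\<in>A. c p * h p x) (topspace X) \<in> vecs (Cp X) \<and>
      L (restrict (\<lambda>x. \<Sum>p\<in>A. c p * h p x) (topspace X)) = (\<Sum>p\<in>A. c p * L (e p))"
    if "A \<subseteq> F" for A c
    using finite_subset[OF that F(1)] that
  proof (induction A)
    case empty
    have z: "restrict (\<lambda>x. 0 :: real) (topspace X) \<in> vecs (Cp X)" by (rule restrict_in_Cp) simp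
    have "L (restrict (\<lambda>x. 0 :: real) (topspace X)) = 0"
    proof (rule F0[OF z])
      show "\<forall>x\<in>F. restrict (\<lambda>x. 0 :: real) (topspace X) x = 0" using F(2) by auto
    qed
    with z show ?case by (simp only: sum.empty simp_thms)
  next
    case (insert p A)
    have "restrict (\<lambda>x. \<Sum>p\<in>insert p A. c p * h p x) (topspace X)
        = vadd (Cp X) (vscale (Cp X) (c p) (e p)) (restrict (\<lambda>x. \<Sum>p\<in>A. c p * h p x) (topspace X))"
      using insert by (auto simp: vadd_Cp vscale_Cp e_def)
    moreover have IH: "restrict (\<lambda>x. \<Sum>p\<in>A. c p * h p x) (topspace X) \<in> vecs (Cp X)"
      "L (restrict (\<lambda>x. \<Sum>p\<in>A. c p * h p x) (topspace X)) = (\<Sum>p\<in>A. c p * L (e p))"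
      using insert.IH insert.prems by blast+
    moreover have "e p \<in> vecs (Cp X)" using insert.prems by (intro e) simp
    ultimately show ?case
      by (simp only: vadd_Cp_closed vscale_Cp_closed add scale sum.insert[OF insert.hyps] simp_thms)
  qed
  define \<mu> where "\<mu> x = (if x \<in> F then L (e x) else 0)" for x
  have \<mu>F: "{x. \<mu> x \<noteq> 0} \<subseteq> F" by (auto simp: \<mu>_def)
  show ?thesis
  proof (intro bexI ballI)
    show "\<mu> \<in> Cp_dual X" using \<mu>F F finite_subset by (auto simp: Cp_dual_def)
    fix f assume f: "f \<in> vecs (Cp X)"
    let ?g = "restrict (\<lambda>x. \<Sum>p\<in>F. f p * h p x) (topspace X)"
    let ?d = "vadd (Cp X) f (vscale (Cp X) (- 1) ?g)"
    have g: "?g \<in> vecs (Cp X)" "L ?g = (\<Sum>p\<in>F. f p * L (e p))" using comb[of F f] by auto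
    have gf: "(\<Sum>p\<in>F. f p * h p x) = f x" if x: "x \<in> F" for x
    proof -
      have "(\<Sum>p\<in>F. f p * h p x) = (\<Sum>p\<in>F. if p = x then f x else 0)"
        using x h(2) by (intro sum.cong) auto
      then show ?thesis using x F(1) by simp
    qed
    have "\<forall>x\<in>F. ?d x = 0"
      using F(2) gf by (auto simp: vadd_Cp vscale_Cp)
    then have "L ?d = 0"
      using f g(1) by (intro F0 vadd_Cp_closed vscale_Cp_closed)
    then have "L f = L ?g" using f g(1) by (simp add: add scale vscale_Cp_closed)
    also have "\<dots> = (\<Sum>p\<in>F. \<mu> p * f p)" unfolding g(2) by (rule sum.cong) (auto simp: \<mu>_def)
    also have "\<dots> = dual_apply \<mu> f" using dual_apply_superset[OF F(1) \<mu>F] by simp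
    finally show "L f = dual_apply \<mu> f" .
  qed
qed

section \<open>Complements and quotients from a null sequence of measures\<close>

lemma seq_space_ops:
  "vadd (seq_space E) x y = (\<lambda>k. x k + y k)" "vscale (seq_space E) c x = (\<lambda>k. c * x k)"
  by (simp_all add: pointwise_def restrict_def)

lemma topo_seq_space: "topo (seq_space E) = subtopology (product_topology (\<lambda>_. euclideanreal) UNIV) E"
  by (simp add: pointwise_def)

lemma continuous_map_seq_space:
  "continuous_map Y (topo (seq_space E)) T \<longleftrightarrow>
     T ` topspace Y \<subseteq> E \<and> (\<forall>k. continuous_map Y euclideanreal (\<lambda>f. T f k))"
  unfolding topo_seq_space continuous_map_in_subtopology continuous_map_componentwise_UNIV
  by auto

lemma continuous_map_seq_space_coord: "continuous_map (topo (seq_space E)) euclideanreal (\<lambda>x. x k)"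
  using continuous_map_seq_space[of "topo (seq_space E)" E "\<lambda>x. x"] by (simp add: vecs_seq_space)

lemma linear_subspace_c0: "linear_subspace (seq_space c0) (vecs (seq_space c0))"
  unfolding linear_subspace_def vecs_seq_space seq_space_ops
proof (intro conjI ballI allI)
  have "(\<lambda>_. 0) \<in> c0" by (simp add: c0_def)
  then show "c0 \<noteq> {}" by blast
  show "(\<lambda>k. x k + y k) \<in> c0" if "x \<in> c0" "y \<in> c0" for x y
    using that tendsto_add[of x 0 sequentially y 0] by (simp add: c0_def)
  show "(\<lambda>k. c * x k) \<in> c0" if "x \<in> c0" for x c
    using that tendsto_mult_left[of x 0 sequentially c] by (simp add: c0_def)
qed simp

text \<open>
  At \<open>x\<close> only the bump with index \<open>\<iota> x\<close> can be non-zero, so the series is a single term that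
  depends on only one coordinate of \<open>c\<close>; at points where all bumps vanish, \<open>\<iota> x\<close> is an arbitrary
  index. Since \<open>c\<close> tends to 0, the series converges uniformly.
\<close>

lemma disjoint_bump_series:
  fixes h :: "nat \<Rightarrow> 'a \<Rightarrow> real"
  assumes cont: "\<And>k. continuous_map X euclideanreal (h k)" and le1: "\<And>k x. \<bar>h k x\<bar> \<le> 1"
    and disj: "\<forall>x\<in>topspace X. \<forall>j k. h j x \<noteq> 0 \<longrightarrow> h k x \<noteq> 0 \<longrightarrow> j = k"
  obtains \<iota> where "\<And>x c. x \<in> topspace X \<Longrightarrow> (\<lambda>k. c k * h k x) sums (c (\<iota> x) * h (\<iota> x) x)"
    "\<And>c. c \<in> c0 \<Longrightarrow> continuous_map X euclideanreal (\<lambda>x. c (\<iota> x) * h (\<iota> x) x)"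
proof -
  define \<iota> where "\<iota> x = (SOME j. h j x \<noteq> 0)" for x
  have \<iota>: "h k x = 0" if "x \<in> topspace X" "k \<noteq> \<iota> x" for k x
  proof (rule ccontr)
    assume "h k x \<noteq> 0"
    then have "h (\<iota> x) x \<noteq> 0" unfolding \<iota>_def by (rule someI)
    with \<open>h k x \<noteq> 0\<close> show False using disj that by blast
  qed
  show ?thesis
  proof
    show "(\<lambda>k. c k * h k x) sums (c (\<iota> x) * h (\<iota> x) x)" if "x \<in> topspace X" for x c
      using sums_finite[of "{\<iota> x}" "\<lambda>k. c k * h k x"] \<iota>[OF that] by auto
    fix c assume c: "c \<in> c0"
    show "continuous_map X euclideanreal (\<lambda>x. c (\<iota> x) * h (\<iota> x) x)"
    proof (rule continuous_map_uniform_suminf)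
      show "continuous_map X euclideanreal (\<lambda>x. c k * h k x)" for k
        using cont by (rule continuous_map_real_mult_left)
      fix e :: real assume "0 < e"
      then have "\<forall>\<^sub>F k in sequentially. \<bar>c k\<bar> < e"
        using c tendstoD[of c 0 sequentially e] by (simp add: c0_def)
      then obtain K where K: "\<And>k. k \<ge> K \<Longrightarrow> \<bar>c k\<bar> < e" by (auto simp: eventually_sequentially)
      show "\<forall>\<^sub>F N in sequentially. \<forall>x\<in>topspace X.
          \<bar>c (\<iota> x) * h (\<iota> x) x - (\<Sum>k<N. c k * h k x)\<bar> < e"
        using eventually_ge_at_top[of K]
      proof eventually_elim
        case (elim N)
        show ?case
        proof
          fix x assume x: "x \<in> topspace X"
          have "(\<Sum>k<N. c k * h k x) = (\<Sum>k<N. if k = \<iota> x then c (\<iota> x) * h (\<iota> x) x else 0)"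
            using \<iota>[OF x] by (intro sum.cong) auto
          then have sum: "(\<Sum>k<N. c k * h k x) = (if \<iota> x < N then c (\<iota> x) * h (\<iota> x) x else 0)"
            by simp
          show "\<bar>c (\<iota> x) * h (\<iota> x) x - (\<Sum>k<N. c k * h k x)\<bar> < e"
          proof (cases "\<iota> x < N")
            case True then show ?thesis using sum \<open>0 < e\<close> by simp
          next
            case False
            have "\<bar>c (\<iota> x) * h (\<iota> x) x\<bar> \<le> \<bar>c (\<iota> x)\<bar>"
              using le1[of "\<iota> x" x] by (simp add: abs_mult mult_left_le)
            also have "\<dots> < e" using K False elim by simp
            finally show ?thesis using sum False by simp
          qed
        qed
      qed
    qed
  qed
qed

text \<open>
  \<open>S\<close> synthesizes a function from its coefficients with respect to the bumps, and \<open>R\<close> recovers the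
  coefficients from the values of the measures by solving the triangular system. The matrix \<open>a\<close> and
  the formula for \<open>R\<close> are part of the conclusion, since prescribing the values
  \<open>\<nu> (r k) f\<close> themselves needs both.
\<close>

lemma JN_sequence_retraction:
  fixes \<nu> :: "nat \<Rightarrow> 'a \<Rightarrow> real"
  assumes X: "completely_regular_space X" "Hausdorff_space X" and JN: "JN_sequence X \<nu>"
  obtains r a R S where "strict_mono r"
    "\<And>k. a k k \<noteq> 0" "\<And>y. y \<in> c0 \<Longrightarrow> forward_substitution a y \<in> c0"
    "\<And>f. R f = forward_substitution a (\<lambda>k. dual_apply (\<nu> (r k)) f)"
    "linear_between (Cp X) (seq_space c0) R" "continuous_map (topo (Cp X)) (topo (seq_space c0)) R"
    "linear_between (seq_space c0) (Cp X) S" "continuous_map (topo (seq_space c0)) (topo (Cp X)) S"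
    "\<And>c. c \<in> c0 \<Longrightarrow> R (S c) = c"
proof -
  note \<nu> = JN_sequenceD(1)[OF JN] and null = JN_sequenceD(3)[OF JN]
  obtain r :: "nat \<Rightarrow> nat" and h :: "nat \<Rightarrow> 'a \<Rightarrow> real" where r: "strict_mono r"
    and h: "\<And>k. continuous_map X euclideanreal (h k)" "\<And>k x. \<bar>h k x\<bar> \<le> 1"
    and disj: "\<forall>x\<in>topspace X. \<forall>j k. h j x \<noteq> 0 \<longrightarrow> h k x \<noteq> 0 \<longrightarrow> j = k"
    and upper: "\<And>j k. k < j \<Longrightarrow> dual_apply (\<nu> (r k)) (h j) = 0"
    and diag: "\<And>k. 1 / 4 \<le> dual_apply (\<nu> (r k)) (h k)"
    and off: "\<And>k. (\<Sum>j<k. \<bar>dual_apply (\<nu> (r k)) (h j)\<bar>) \<le> 1 / 8"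
    by (rule triangular_bump_system[OF X JN]) (rule that)
  obtain \<iota> where \<iota>: "\<And>x c. x \<in> topspace X \<Longrightarrow> (\<lambda>k. c k * h k x) sums (c (\<iota> x) * h (\<iota> x) x)"
    "\<And>c. c \<in> c0 \<Longrightarrow> continuous_map X euclideanreal (\<lambda>x. c (\<iota> x) * h (\<iota> x) x)"
    by (rule disjoint_bump_series[OF h disj]) (rule that)
  define a where "a k j = dual_apply (\<nu> (r k)) (h j)" for k j
  define R where "R f = forward_substitution a (\<lambda>k. dual_apply (\<nu> (r k)) f)" for f
  define S where "S c = restrict (\<lambda>x. c (\<iota> x) * h (\<iota> x) x) (topspace X)" for c :: "nat \<Rightarrow> real"
  have null': "(\<lambda>k. dual_apply (\<nu> (r k)) f) \<longlonglongrightarrow> 0" if "continuous_map X euclideanreal f" for f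
    using LIMSEQ_subseq_LIMSEQ[OF null[OF that] r] by (simp add: o_def)
  have fs_c0: "forward_substitution a y \<in> c0" if "y \<in> c0" for y
    using that null'[OF h(1)] diag off unfolding c0_def a_def
    by (intro CollectI forward_substitution_null) auto
  have R_c0: "R f \<in> c0" if "f \<in> vecs (Cp X)" for f
    unfolding R_def using null'[OF vecs_CpD(1)[OF that]] by (intro fs_c0) (simp add: c0_def)
  have S_Cp: "S c \<in> vecs (Cp X)" if "c \<in> c0" for c
    unfolding S_def using \<iota>(2)[OF that] by (rule restrict_in_Cp)
  have a_ne: "a k k \<noteq> 0" for k using diag[of k] by (simp add: a_def)
  show ?thesis
  proof
    show "strict_mono r" by fact
    show "a k k \<noteq> 0" for k by (fact a_ne)
    show "forward_substitution a y \<in> c0" if "y \<in> c0" for y using that by (rule fs_c0)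
    show "R f = forward_substitution a (\<lambda>k. dual_apply (\<nu> (r k)) f)" for f by (fact R_def)
    show "linear_between (Cp X) (seq_space c0) R"
      unfolding linear_between_def vecs_seq_space
    proof (intro conjI ballI allI)
      show "R ` vecs (Cp X) \<subseteq> c0" using R_c0 by blast
      show "R (vadd (Cp X) f g) = vadd (seq_space c0) (R f) (R g)" for f g
        by (simp add: R_def vadd_Cp seq_space_ops dual_apply_restrict[OF \<nu>] dual_apply_add
            forward_substitution_add fun_eq_iff)
      show "R (vscale (Cp X) c f) = vscale (seq_space c0) c (R f)" for f c
        by (simp add: R_def vscale_Cp seq_space_ops dual_apply_restrict[OF \<nu>] dual_apply_scale
            forward_substitution_scale fun_eq_iff)
    qed
    show "continuous_map (topo (Cp X)) (topo (seq_space c0)) R"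
      unfolding continuous_map_seq_space R_def
      using R_c0 by (auto simp: R_def intro: continuous_map_forward_substitution continuous_map_dual_apply[OF \<nu>])
    show "linear_between (seq_space c0) (Cp X) S"
      unfolding linear_between_def vecs_seq_space
    proof (intro conjI ballI allI)
      show "S ` c0 \<subseteq> vecs (Cp X)" using S_Cp by blast
      show "S (vadd (seq_space c0) c d) = vadd (Cp X) (S c) (S d)" for c d
        by (auto simp: S_def vadd_Cp seq_space_ops algebra_simps)
      show "S (vscale (seq_space c0) t c) = vscale (Cp X) t (S c)" for t c
        by (auto simp: S_def vscale_Cp seq_space_ops algebra_simps)
    qed
    show "continuous_map (topo (seq_space c0)) (topo (Cp X)) S"
      unfolding topo_Cp continuous_map_in_subtopology continuous_map_componentwise
    proof (intro conjI ballI)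
      show "S ` vecs (seq_space c0) \<subseteq> extensional (topspace X)" by (auto simp: S_def)
      show "continuous_map (topo (seq_space c0)) euclideanreal (\<lambda>c. S c x)" if "x \<in> topspace X" for x
        unfolding S_def using that
        by (simp add: continuous_map_real_mult_right continuous_map_seq_space_coord)
      show "S \<in> vecs (seq_space c0) \<rightarrow> {f. continuous_map X euclideanreal f}"
        using S_Cp vecs_CpD(1) by (auto simp: vecs_seq_space)
    qed
    show "R (S c) = c" if "c \<in> c0" for c
      unfolding R_def
    proof (rule forward_substitution_unique[OF a_ne])
      fix k
      have "(\<lambda>j. dual_apply (\<nu> (r k)) (\<lambda>x. c j * h j x)) sums dual_apply (\<nu> (r k)) (S c)"
        by (rule dual_apply_sums[OF \<nu>]) (simp add: S_def \<iota>(1))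
      moreover have "dual_apply (\<nu> (r k)) (\<lambda>x. c j * h j x) = a k j * c j" for j
        by (simp add: dual_apply_scale a_def)
      moreover have "(\<lambda>j. a k j * c j) sums (\<Sum>j\<le>k. a k j * c j)"
        using upper[of k] by (intro sums_finite) (auto simp: a_def)
      ultimately show "(\<Sum>j\<le>k. a k j * c j) = dual_apply (\<nu> (r k)) (S c)"
        by (simp add: sums_unique2)
    qed
  qed
qed

lemma retraction_gives_complement:
  assumes R: "linear_between V W R" "continuous_map (topo V) (topo W) R"
    and S: "linear_between W V S" "continuous_map (topo W) (topo V) S"
    and RS: "\<forall>w\<in>vecs W. R (S w) = w" and W: "linear_subspace W (vecs W)"
  shows "complemented_in V (S ` vecs W)" "isomorphic (subspace_of V (S ` vecs W)) W"
proof -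
  have RW: "R v \<in> vecs W" if "v \<in> vecs V" for v using R(1) that by (auto simp: linear_between_def)
  have SV: "S w \<in> vecs V" if "w \<in> vecs W" for w using S(1) that by (auto simp: linear_between_def)
  show "complemented_in V (S ` vecs W)"
    unfolding complemented_in_def
  proof (intro conjI exI[of _ "S \<circ> R"])
    show "linear_subspace V (S ` vecs W)"
      unfolding linear_subspace_def
    proof (intro conjI ballI allI)
      show "S ` vecs W \<subseteq> vecs V" using SV by blast
      show "S ` vecs W \<noteq> {}" using W by (simp add: linear_subspace_def)
    next
      fix a b assume "a \<in> S ` vecs W" "b \<in> S ` vecs W"
      then obtain u v where uv: "u \<in> vecs W" "v \<in> vecs W" "a = S u" "b = S v" by blast
      then have "vadd V a b = S (vadd W u v)" "vadd W u v \<in> vecs W"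
        using S(1) W by (simp_all add: linear_between_def linear_subspace_def)
      then show "vadd V a b \<in> S ` vecs W" by blast
    next
      fix c a assume "a \<in> S ` vecs W"
      then obtain u where u: "u \<in> vecs W" "a = S u" by blast
      then have "vscale V c a = S (vscale W c u)" "vscale W c u \<in> vecs W"
        using S(1) W by (simp_all add: linear_between_def linear_subspace_def)
      then show "vscale V c a \<in> S ` vecs W" by blast
    qed
    show "linear_between V V (S \<circ> R)"
      using R(1) S(1) RW SV by (auto simp: linear_between_def)
    show "continuous_map (topo V) (topo V) (S \<circ> R)"
      using R(2) S(2) by (rule continuous_map_compose)
    show "(S \<circ> R) ` vecs V = S ` vecs W"
    proof
      show "(S \<circ> R) ` vecs V \<subseteq> S ` vecs W" using RW by auto
      show "S ` vecs W \<subseteq> (S \<circ> R) ` vecs V"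
      proof
        fix a assume "a \<in> S ` vecs W"
        then obtain w where w: "w \<in> vecs W" "a = S w" by blast
        then have "(S \<circ> R) (S w) = a" using RS by simp
        then show "a \<in> (S \<circ> R) ` vecs V" using SV[OF w(1)] by (metis image_eqI)
      qed
    qed
    show "\<forall>v\<in>vecs V. (S \<circ> R) ((S \<circ> R) v) = (S \<circ> R) v"
      using RW RS by simp
  qed
  have vs: "vecs (subspace_of V (S ` vecs W)) = S ` vecs W"
    using SV by (auto simp: subspace_of_def)
  show "isomorphic (subspace_of V (S ` vecs W)) W"
    unfolding isomorphic_def
  proof (intro exI[of _ R] conjI)
    show "linear_between (subspace_of V (S ` vecs W)) W R"
      using R(1) SV unfolding linear_between_def vs by (auto simp: subspace_of_def)
    have "homeomorphic_maps (topo (subspace_of V (S ` vecs W))) (topo W) R S"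
      unfolding homeomorphic_maps_def vs using R(2) S(2) RS
      by (auto simp: subspace_of_def continuous_map_from_subtopology continuous_map_in_subtopology)
    then show "homeomorphic_map (topo (subspace_of V (S ` vecs W))) (topo W) R"
      using homeomorphic_map_maps by blast
  qed
qed

lemma vadd_Cp_cancel:
  assumes "v \<in> vecs (Cp X)" "w \<in> vecs (Cp X)"
  shows "vadd (Cp X) v (vadd (Cp X) w (vscale (Cp X) (- 1) v)) = w"
proof -
  have "vadd (Cp X) v (vadd (Cp X) w (vscale (Cp X) (- 1) v)) = restrict w (topspace X)"
    by (auto simp: vadd_Cp vscale_Cp)
  then show ?thesis using vecs_CpD(2)[OF assms(2)] by simp
qed

text \<open>
  The quotient is taken by the kernel \<open>N\<close> of \<open>R\<close>. Its cosets are the fibres of \<open>R\<close>, and the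
  induced bijection has the continuous inverse \<open>y \<mapsto> S y + N\<close>.
\<close>

lemma retraction_gives_quotient:
  assumes R: "linear_between (Cp X) (seq_space E) R" "continuous_map (topo (Cp X)) (topo (seq_space E)) R"
    and S: "continuous_map (topo (seq_space E)) (topo (Cp X)) S"
    and retract: "\<forall>y\<in>vecs (seq_space E). R (S y) = y"
  shows "\<exists>N. linear_subspace (Cp X) N \<and> closedin (topo (Cp X)) N \<and>
           isomorphic (quotient_space (Cp X) N) (seq_space E)"
proof -
  let ?V = "Cp X"
  define N where "N = {f \<in> vecs ?V. R f = (\<lambda>_. 0)}"
  have RS: "R (S y) = y" if "y \<in> E" for y using retract that by (simp add: vecs_seq_space)
  define fib where "fib f = {g \<in> vecs ?V. R g = R f}" for f
  have add: "R (vadd ?V f g) = (\<lambda>k. R f k + R g k)" if "f \<in> vecs ?V" "g \<in> vecs ?V" for f g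
    using R(1) that by (simp add: linear_between_def seq_space_ops)
  have scale: "R (vscale ?V c f) = (\<lambda>k. c * R f k)" if "f \<in> vecs ?V" for f c
    using R(1) that by (simp add: linear_between_def seq_space_ops)
  have RE: "R f \<in> E" if "f \<in> vecs ?V" for f
    using R(1) that by (auto simp: linear_between_def vecs_seq_space)
  have SV: "S y \<in> vecs ?V" if "y \<in> E" for y
    using continuous_map_image_subset_topspace[OF S] that by (auto simp: vecs_seq_space)
  have z: "restrict (\<lambda>_. 0) (topspace X) \<in> vecs ?V" by (rule restrict_in_Cp) simp
  have "linear_subspace ?V N"
    unfolding linear_subspace_def
  proof (intro conjI ballI allI)
    have "vscale ?V 0 (restrict (\<lambda>_. 0) (topspace X)) \<in> N"
      unfolding N_def using z by (simp add: scale vscale_Cp_closed)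
    then show "N \<noteq> {}" by blast
  qed (auto simp: N_def add scale vadd_Cp_closed vscale_Cp_closed)
  moreover have "closedin (topo ?V) N"
  proof -
    have "continuous_map (topo ?V) euclideanreal (\<lambda>f. R f k)" for k
      using R(2) by (simp add: continuous_map_seq_space)
    then have "closedin (topo ?V) {f \<in> vecs ?V. R f k \<in> {0}}" for k
      by (rule closedin_continuous_map_preimage) simp
    then have "closedin (topo ?V) (\<Inter>k. {f \<in> vecs ?V. R f k \<in> {0}})"
      by (intro closedin_Inter) auto
    also have "(\<Inter>k. {f \<in> vecs ?V. R f k \<in> {0}}) = N" by (auto simp: N_def)
    finally show ?thesis .
  qed
  moreover have coset: "coset_of ?V N f = fib f" if f: "f \<in> vecs ?V" for f
  proof
    show "coset_of ?V N f \<subseteq> fib f"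
      using f by (auto simp: coset_of_def fib_def N_def add vadd_Cp_closed)
    show "fib f \<subseteq> coset_of ?V N f"
    proof
      fix g assume g: "g \<in> fib f"
      let ?n = "vadd ?V g (vscale ?V (- 1) f)"
      have "?n \<in> N" using f g by (simp add: fib_def N_def add scale vadd_Cp_closed vscale_Cp_closed)
      moreover have "g = vadd ?V f ?n" using vadd_Cp_cancel[OF f, of g] g by (simp add: fib_def)
      ultimately show "g \<in> coset_of ?V N f" unfolding coset_of_def by blast
    qed
  qed
  let ?Q = "quotient_space ?V N"
  have topoQ: "topo ?Q = quotient_topology (topo ?V) (coset_of ?V N)"
    by (simp add: quotient_space_def)
  have vecsQ: "vecs ?Q = fib ` vecs ?V"
    using coset by (simp add: topoQ topspace_quotient_topology)
  define R' where "R' A = R (SOME f. f \<in> A)" for A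
  have R'_eq: "R' A = y" if "A \<noteq> {}" "\<And>f. f \<in> A \<Longrightarrow> R f = y" for A y
    unfolding R'_def using that some_in_eq[of A] by blast
  have R'_fib: "R' (fib f) = R f" if "f \<in> vecs ?V" for f
    by (rule R'_eq) (use that in \<open>auto simp: fib_def\<close>)
  have "isomorphic ?Q (seq_space E)"
    unfolding isomorphic_def
  proof (intro exI[of _ R'] conjI)
    show "linear_between ?Q (seq_space E) R'"
      unfolding linear_between_def
    proof (intro conjI ballI allI)
      show "R' ` vecs ?Q \<subseteq> vecs (seq_space E)"
        using RE by (auto simp: vecsQ vecs_seq_space R'_fib)
    next
      fix A B assume "A \<in> vecs ?Q" "B \<in> vecs ?Q"
      then obtain f g where fg: "f \<in> vecs ?V" "g \<in> vecs ?V" "A = fib f" "B = fib g"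
        by (auto simp: vecsQ)
      have "R' (vadd ?Q A B) = (\<lambda>k. R f k + R g k)"
        by (rule R'_eq) (use fg in \<open>auto simp: quotient_space_def fib_def add\<close>)
      then show "R' (vadd ?Q A B) = vadd (seq_space E) (R' A) (R' B)"
        using fg by (simp add: seq_space_ops R'_fib)
    next
      fix c A assume "A \<in> vecs ?Q"
      then obtain f where f: "f \<in> vecs ?V" "A = fib f" by (auto simp: vecsQ)
      have "N \<noteq> {}" using \<open>linear_subspace ?V N\<close> by (simp add: linear_subspace_def)
      have "R' (vscale ?Q c A) = (\<lambda>k. c * R f k)"
      proof (rule R'_eq)
        show "vscale ?Q c A \<noteq> {}"
          using f \<open>N \<noteq> {}\<close> by (auto simp: quotient_space_def fib_def)
        show "R h = (\<lambda>k. c * R f k)" if "h \<in> vscale ?Q c A" for h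
          using that f by (auto simp: quotient_space_def fib_def N_def add scale vscale_Cp_closed)
      qed
      then show "R' (vscale ?Q c A) = vscale (seq_space E) c (R' A)"
        using f by (simp add: seq_space_ops R'_fib)
    qed
    have "homeomorphic_maps (topo ?Q) (topo (seq_space E)) R' (coset_of ?V N \<circ> S)"
      unfolding homeomorphic_maps_def
    proof (intro conjI ballI)
      have "continuous_map (topo ?V) (topo (seq_space E)) (R' \<circ> coset_of ?V N)"
        using R(2) by (rule continuous_map_eq) (simp add: coset R'_fib)
      then show "continuous_map (topo ?Q) (topo (seq_space E)) R'"
        unfolding topoQ by (rule continuous_compose_quotient_map[OF quotient_map_quotient_topology])
      have "continuous_map (topo ?V) (topo ?Q) (coset_of ?V N)"
        unfolding topoQ by (rule quotient_imp_continuous_map[OF quotient_map_quotient_topology])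
      with S show "continuous_map (topo (seq_space E)) (topo ?Q) (coset_of ?V N \<circ> S)"
        by (rule continuous_map_compose)
      show "(coset_of ?V N \<circ> S) (R' A) = A" if A: "A \<in> vecs ?Q" for A
      proof -
        obtain f where f: "f \<in> vecs ?V" "A = fib f" using A by (auto simp: vecsQ)
        then show ?thesis using RE[OF f(1)] by (simp add: R'_fib coset SV) (simp add: fib_def RS)
      qed
      show "R' ((coset_of ?V N \<circ> S) y) = y" if "y \<in> vecs (seq_space E)" for y
        using that by (simp add: vecs_seq_space coset SV R'_fib RS)
    qed
    then show "homeomorphic_map (topo ?Q) (topo (seq_space E)) R'"
      using homeomorphic_map_maps by blast
  qed
  ultimately show ?thesis by blast
qed

section \<open>Surjections from complemented subspaces and from quotients\<close>

lemma surjection_from_complement: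
  assumes "complemented_in V S" "isomorphic (subspace_of V S) W"
  shows "\<exists>T. linear_between V W T \<and> continuous_map (topo V) (topo W) T \<and> T ` vecs V = vecs W"
proof -
  obtain P where P: "linear_between V V P" "continuous_map (topo V) (topo V) P" "P ` vecs V = S"
    and S: "linear_subspace V S"
    using assms(1) by (auto simp: complemented_in_def)
  obtain I where I: "linear_between (subspace_of V S) W I"
    "homeomorphic_map (topo (subspace_of V S)) (topo W) I"
    using assms(2) by (auto simp: isomorphic_def)
  have SV: "S \<subseteq> vecs V" using S by (simp add: linear_subspace_def)
  have vecsS: "vecs (subspace_of V S) = S" using SV by (auto simp: subspace_of_def)
  have PS: "P v \<in> S" if "v \<in> vecs V" for v using P(3) that by blast
  show ?thesis
  proof (intro exI[of _ "I \<circ> P"] conjI)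
    show "linear_between V W (I \<circ> P)"
      using P(1) I(1) PS unfolding linear_between_def vecsS
      by (auto simp: subspace_of_def)
    have "continuous_map (topo V) (topo (subspace_of V S)) P"
      using P(2) PS by (auto simp: subspace_of_def continuous_map_in_subtopology)
    then show "continuous_map (topo V) (topo W) (I \<circ> P)"
      using homeomorphic_imp_continuous_map[OF I(2)] by (rule continuous_map_compose)
    show "(I \<circ> P) ` vecs V = vecs W"
      using homeomorphic_imp_surjective_map[OF I(2)] by (simp only: vecsS image_comp [symmetric] P(3))
  qed
qed

lemma surjection_from_quotient:
  assumes N: "linear_subspace (Cp X) N" and iso: "isomorphic (quotient_space (Cp X) N) W"
  shows "\<exists>T. linear_between (Cp X) W T \<and> continuous_map (topo (Cp X)) (topo W) T \<and>
    T ` vecs (Cp X) = vecs W"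
proof -
  let ?V = "Cp X"
  let ?Q = "quotient_space ?V N"
  let ?q = "coset_of ?V N"
  obtain I where I: "linear_between ?Q W I" "homeomorphic_map (topo ?Q) (topo W) I"
    using iso by (auto simp: isomorphic_def)
  have NV: "N \<subseteq> vecs ?V" and Nadd: "\<And>m n. m \<in> N \<Longrightarrow> n \<in> N \<Longrightarrow> vadd ?V m n \<in> N"
    and Nscale: "\<And>c n. n \<in> N \<Longrightarrow> vscale ?V c n \<in> N" and "N \<noteq> {}"
    using N by (auto simp: linear_subspace_def)
  have N0: "restrict (\<lambda>_. 0) (topspace X) \<in> N"
  proof -
    obtain n where "n \<in> N" using \<open>N \<noteq> {}\<close> by blast
    then show ?thesis using Nscale[of n 0] by (simp add: vscale_Cp)
  qed
  have quot: "quotient_map (topo ?V) (topo ?Q) ?q"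
    by (simp add: quotient_space_def quotient_map_quotient_topology)
  have vecsQ: "vecs ?Q = ?q ` vecs ?V"
    by (simp add: quotient_space_def topspace_quotient_topology)
  have q_add: "?q (vadd ?V f g) = vadd ?Q (?q f) (?q g)" for f g
  proof
    show "?q (vadd ?V f g) \<subseteq> vadd ?Q (?q f) (?q g)"
    proof
      fix h assume "h \<in> ?q (vadd ?V f g)"
      then obtain n where n: "n \<in> N" "h = vadd ?V (vadd ?V f g) n" by (auto simp: coset_of_def)
      have "h = vadd ?V (vadd ?V f (restrict (\<lambda>_. 0) (topspace X))) (vadd ?V g n)"
        using n(2) by (auto simp: vadd_Cp)
      then show "h \<in> vadd ?Q (?q f) (?q g)"
        using n(1) N0 by (auto simp: quotient_space_def coset_of_def)
    qed
    show "vadd ?Q (?q f) (?q g) \<subseteq> ?q (vadd ?V f g)"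
    proof
      fix h assume "h \<in> vadd ?Q (?q f) (?q g)"
      then obtain m n where mn: "m \<in> N" "n \<in> N" "h = vadd ?V (vadd ?V f m) (vadd ?V g n)"
        by (auto simp: quotient_space_def coset_of_def)
      have "h = vadd ?V (vadd ?V f g) (vadd ?V m n)"
        using mn(3) by (auto simp: vadd_Cp)
      then show "h \<in> ?q (vadd ?V f g)" using Nadd[OF mn(1,2)] by (auto simp: coset_of_def)
    qed
  qed
  have q_scale: "?q (vscale ?V c f) = vscale ?Q c (?q f)" for c f
  proof
    show "?q (vscale ?V c f) \<subseteq> vscale ?Q c (?q f)"
    proof
      fix h assume "h \<in> ?q (vscale ?V c f)"
      then obtain n where n: "n \<in> N" "h = vadd ?V (vscale ?V c f) n" by (auto simp: coset_of_def)
      have "h = vadd ?V (vscale ?V c (vadd ?V f (restrict (\<lambda>_. 0) (topspace X)))) n"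
        using n(2) by (auto simp: vadd_Cp vscale_Cp)
      then show "h \<in> vscale ?Q c (?q f)"
        using n(1) N0 by (auto simp: quotient_space_def coset_of_def)
    qed
    show "vscale ?Q c (?q f) \<subseteq> ?q (vscale ?V c f)"
    proof
      fix h assume "h \<in> vscale ?Q c (?q f)"
      then obtain m n where mn: "m \<in> N" "n \<in> N" "h = vadd ?V (vscale ?V c (vadd ?V f m)) n"
        by (auto simp: quotient_space_def coset_of_def)
      have "h = vadd ?V (vscale ?V c f) (vadd ?V (vscale ?V c m) n)"
        using mn(3) by (auto simp: vadd_Cp vscale_Cp distrib_left)
      then show "h \<in> ?q (vscale ?V c f)"
        using Nadd[OF Nscale[OF mn(1)] mn(2)] by (auto simp: coset_of_def)
    qed
  qed
  show ?thesis
  proof (intro exI[of _ "I \<circ> ?q"] conjI)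
    show "linear_between ?V W (I \<circ> ?q)"
      using I(1) unfolding linear_between_def vecsQ by (auto simp: q_add q_scale)
    show "continuous_map (topo ?V) (topo W) (I \<circ> ?q)"
      using quotient_imp_continuous_map[OF quot] homeomorphic_imp_continuous_map[OF I(2)]
      by (rule continuous_map_compose)
    show "(I \<circ> ?q) ` vecs ?V = vecs W"
      using homeomorphic_imp_surjective_map[OF I(2)] by (simp only: image_comp [symmetric] vecsQ)
  qed
qed

section \<open>Surjections onto symmetric sequence ideals\<close>

lemma Josefson_Nissenzweig_iff_JN_sequence:
  "Josefson_Nissenzweig X \<longleftrightarrow> (\<exists>\<nu>. JN_sequence X \<nu>)"
proof -
  have "(\<forall>f\<in>vecs (Cp X). (\<lambda>n. dual_apply (\<nu> n) f) \<longlonglongrightarrow> 0) \<longleftrightarrow>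
      (\<forall>f. continuous_map X euclideanreal f \<longrightarrow> (\<lambda>n. dual_apply (\<nu> n) f) \<longlonglongrightarrow> 0)"
    if \<nu>: "\<And>n. \<nu> n \<in> Cp_dual X" for \<nu> :: "nat \<Rightarrow> 'a \<Rightarrow> real"
  proof (intro iffI ballI allI impI)
    fix f assume "\<forall>f\<in>vecs (Cp X). (\<lambda>n. dual_apply (\<nu> n) f) \<longlonglongrightarrow> 0" "continuous_map X euclideanreal f"
    then have "(\<lambda>n. dual_apply (\<nu> n) (restrict f (topspace X))) \<longlonglongrightarrow> 0"
      using restrict_in_Cp by blast
    then show "(\<lambda>n. dual_apply (\<nu> n) f) \<longlonglongrightarrow> 0"
      by (simp add: dual_apply_restrict[OF \<nu>])
  qed (use vecs_CpD(1) in blast)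
  then show ?thesis unfolding Josefson_Nissenzweig_def JN_sequence_def by blast
qed

lemma Cp_dual_mult: "\<mu> \<in> Cp_dual X \<Longrightarrow> (\<lambda>x. \<mu> x * g x) \<in> Cp_dual X"
  unfolding Cp_dual_def by (auto elim: rev_finite_subset)

lemma dual_apply_mult:
  assumes "\<mu> \<in> Cp_dual X"
  shows "dual_apply (\<lambda>x. \<mu> x * g x) f = dual_apply \<mu> (\<lambda>x. g x * f x)"
proof -
  have fin: "finite {x. \<mu> x \<noteq> 0}" using assms by (simp add: Cp_dual_def)
  have "dual_apply (\<lambda>x. \<mu> x * g x) f = (\<Sum>x | \<mu> x \<noteq> 0. \<mu> x * g x * f x)"
    by (rule dual_apply_superset[OF fin]) auto
  then show ?thesis by (simp add: dual_apply_def mult.assoc)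
qed

lemma dual_norm_mult:
  assumes "\<mu> \<in> Cp_dual X"
  shows "dual_norm (\<lambda>x. \<mu> x * g x) = (\<Sum>x | \<mu> x \<noteq> 0. \<bar>\<mu> x * g x\<bar>)"
  unfolding dual_norm_def using assms by (intro sum.mono_neutral_left) (auto simp: Cp_dual_def)

lemma dual_norm_nonneg: "0 \<le> dual_norm \<mu>"
  by (simp add: dual_norm_def sum_nonneg)

text \<open>
  Multiplying a measure by a continuous weight preserves pointwise convergence to 0 because
  \<open>(g \<mu>) f = \<mu> (g f)\<close>. Along a subsequence on which the norms \<open>w k\<close> of the weighted measures stay
  above \<open>\<epsilon>\<close>, normalization preserves it too.
\<close>

lemma JN_sequence_from_weight:
  fixes \<mu> :: "nat \<Rightarrow> 'a \<Rightarrow> real"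
  assumes \<mu>: "\<And>n. \<mu> n \<in> Cp_dual X"
    and null: "\<forall>f. continuous_map X euclideanreal f \<longrightarrow> (\<lambda>n. dual_apply (\<mu> n) f) \<longlonglongrightarrow> 0"
    and g: "continuous_map X euclideanreal g"
    and not_null: "\<not> (\<lambda>n. dual_norm (\<lambda>x. \<mu> n x * g x)) \<longlonglongrightarrow> 0"
  obtains m w \<epsilon> where "strict_mono m" "0 < \<epsilon>" "\<And>k. \<epsilon> \<le> w k"
    "JN_sequence X (\<lambda>k x. \<mu> (m k) x * (g x / w k))"
proof -
  define W where "W n = dual_norm (\<lambda>x. \<mu> n x * g x)" for n
  obtain \<epsilon> where \<epsilon>: "0 < \<epsilon>" "\<not> (\<forall>\<^sub>F n in sequentially. dist (W n) 0 < \<epsilon>)"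
    using not_null by (auto simp: tendsto_iff W_def)
  have "infinite {n. \<epsilon> \<le> W n}"
  proof
    assume "finite {n. \<epsilon> \<le> W n}"
    then have "\<forall>\<^sub>F n in sequentially. n \<notin> {n. \<epsilon> \<le> W n}"
      by (metis cofinite_eq_sequentially eventually_cofinite mem_Collect_eq not_not finite_subset subsetI)
    then have "\<forall>\<^sub>F n in sequentially. dist (W n) 0 < \<epsilon>"
      by (rule eventually_mono) (auto simp: W_def dual_norm_nonneg)
    with \<epsilon>(2) show False ..
  qed
  then obtain m :: "nat \<Rightarrow> nat" where m: "strict_mono m" "\<And>k. m k \<in> {n. \<epsilon> \<le> W n}"
    using infinite_enumerate by metis
  define w where "w k = W (m k)" for k
  have w: "\<epsilon> \<le> w k" "0 < w k" for k using m(2)[of k] \<epsilon>(1) by (auto simp: w_def)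
  show ?thesis
  proof
    show "JN_sequence X (\<lambda>k x. \<mu> (m k) x * (g x / w k))"
      unfolding JN_sequence_def
    proof (intro conjI allI impI)
      show "(\<lambda>x. \<mu> (m k) x * (g x / w k)) \<in> Cp_dual X" for k
        using \<mu> by (rule Cp_dual_mult)
      have "dual_norm (\<lambda>x. \<mu> (m k) x * (g x / w k)) = w k / w k" for k
      proof -
        have "dual_norm (\<lambda>x. \<mu> (m k) x * (g x / w k))
            = (\<Sum>x | \<mu> (m k) x \<noteq> 0. \<bar>\<mu> (m k) x * g x\<bar> / w k)"
          unfolding dual_norm_mult[OF \<mu>] using w(2)[of k]
          by (intro sum.cong) (auto simp: abs_mult abs_divide)
        also have "\<dots> = w k / w k"
          unfolding sum_divide_distrib [symmetric] dual_norm_mult[OF \<mu>, symmetric] w_def W_def ..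
        finally show ?thesis .
      qed
      then show "dual_norm (\<lambda>x. \<mu> (m k) x * (g x / w k)) = 1" for k
        using w(2)[of k] by simp
      fix f assume f: "continuous_map X euclideanreal f"
      have lim: "(\<lambda>k. dual_apply (\<mu> (m k)) (\<lambda>x. g x * f x)) \<longlonglongrightarrow> 0"
        using LIMSEQ_subseq_LIMSEQ[OF null[rule_format, OF continuous_map_real_mult[OF g f]] m(1)]
        by (simp add: o_def)
      have eq: "dual_apply (\<lambda>x. \<mu> (m k) x * (g x / w k)) f
          = inverse (w k) * dual_apply (\<mu> (m k)) (\<lambda>x. g x * f x)" for k
        unfolding dual_apply_mult[OF \<mu>] dual_apply_scale [symmetric]
        by (simp add: divide_inverse mult_ac)
      show "(\<lambda>k. dual_apply (\<lambda>x. \<mu> (m k) x * (g x / w k)) f) \<longlonglongrightarrow> 0"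
      proof (rule Lim_null_comparison)
        show "\<forall>\<^sub>F k in sequentially. norm (dual_apply (\<lambda>x. \<mu> (m k) x * (g x / w k)) f)
            \<le> inverse \<epsilon> * norm (dual_apply (\<mu> (m k)) (\<lambda>x. g x * f x))"
        proof (intro always_eventually allI)
          fix k
          have "inverse (w k) \<le> inverse \<epsilon>" using w(1)[of k] \<epsilon>(1) by (rule le_imp_inverse_le)
          then show "norm (dual_apply (\<lambda>x. \<mu> (m k) x * (g x / w k)) f)
            \<le> inverse \<epsilon> * norm (dual_apply (\<mu> (m k)) (\<lambda>x. g x * f x))"
            unfolding eq using w(2)[of k] by (simp add: abs_mult mult_right_mono)
        qed
        show "(\<lambda>k. inverse \<epsilon> * norm (dual_apply (\<mu> (m k)) (\<lambda>x. g x * f x))) \<longlonglongrightarrow> 0"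
          using tendsto_mult_left[OF tendsto_norm_zero[OF lim]] by simp
      qed
    qed
  qed (use m \<epsilon> w in auto)
qed

text \<open>
  The points \<open>t k\<close> form a uniformly discrete, hence closed and discrete, subset of the line, so
  Tietze's theorem extends any function on them.
\<close>

lemma continuous_majorant:
  fixes t v :: "nat \<Rightarrow> real"
  assumes "\<And>k. t k + 1 < t (Suc k)"
  obtains \<Phi> :: "real \<Rightarrow> real" where "continuous_on UNIV \<Phi>" "\<And>k. \<Phi> (t k) = v k"
proof -
  have gap: "t j + 1 < t k" if "j < k" for j k
    using that
  proof (induction k)
    case (Suc k)
    then show ?case using assms[of k] by (cases "j = k") auto
  qed simp
  have sep: "j = k" if "dist (t j) (t k) < 1" for j k
  proof (rule linorder_cases[of j k])
    assume "j < k" then show ?thesis using gap[of j k] that by (auto simp: dist_real_def)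
  next
    assume "k < j" then show ?thesis using gap[of k j] that by (auto simp: dist_real_def)
  qed
  have inj: "inj t" using sep by (auto intro!: injI)
  have "uniform_discrete (range t)"
    unfolding uniform_discrete_def using sep by (auto intro!: exI[of _ 1])
  then have "continuous_on (range t) (\<lambda>s. v (inv t s))" "closed (range t)"
    by (auto intro: continuous_on_discrete uniform_discrete_imp_discrete uniform_discrete_imp_closed)
  then obtain \<Phi> where "continuous_on UNIV \<Phi>" "\<And>s. s \<in> range t \<Longrightarrow> \<Phi> s = v (inv t s)"
    using Tietze_unbounded[of "range t" "\<lambda>s. v (inv t s)" UNIV] by (metis closed_closedin subtopology_UNIV)
  then show ?thesis using that inj by (metis inv_f_f rangeI)
qed

text \<open>
  If \<open>f\<close> were unbounded on the supports, one could choose support points \<open>x k\<close> of \<open>\<mu> (n k)\<close>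
  with \<open>\<bar>f (x k)\<bar>\<close> increasing by more than 1, and a continuous \<open>\<Phi>\<close> so large at \<open>\<bar>f (x k)\<bar>\<close>
  that the atom at \<open>x k\<close> alone gives the measure \<open>\<mu> (n k)\<close>, weighted by \<open>\<Phi> \<bar>f\<bar>\<close>, norm at
  least \<open>k\<close>. The norms of the measures with this weight would not tend to 0.
\<close>

lemma bounded_on_supports:
  fixes \<mu> :: "nat \<Rightarrow> 'a \<Rightarrow> real"
  assumes \<mu>: "\<And>n. \<mu> n \<in> Cp_dual X"
    and null: "\<forall>g. continuous_map X euclideanreal g \<longrightarrow> (\<lambda>n. dual_norm (\<lambda>x. \<mu> n x * g x)) \<longlonglongrightarrow> 0"
    and f: "continuous_map X euclideanreal f"
  obtains B where "0 < B" "\<And>n x. \<mu> n x \<noteq> 0 \<Longrightarrow> \<bar>f x\<bar> \<le> B"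
proof -
  have "\<exists>B. \<forall>n x. \<mu> n x \<noteq> 0 \<longrightarrow> \<bar>f x\<bar> \<le> B"
  proof (rule ccontr)
    assume "\<not> ?thesis"
    then have unb: "\<exists>n x. \<mu> n x \<noteq> 0 \<and> B < \<bar>f x\<bar>" for B by (meson not_le)
    have "\<exists>p. \<forall>k. \<mu> (fst (p k)) (snd (p k)) \<noteq> 0 \<and> \<bar>f (snd (p k))\<bar> + 1 < \<bar>f (snd (p (Suc k)))\<bar>"
    proof (rule dependent_nat_choice)
      show "\<exists>p. \<mu> (fst p) (snd p) \<noteq> 0" using unb[of 0] by auto
      show "\<exists>q. \<mu> (fst q) (snd q) \<noteq> 0 \<and> \<bar>f (snd p)\<bar> + 1 < \<bar>f (snd q)\<bar>" for p
        using unb[of "\<bar>f (snd p)\<bar> + 1"] by auto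
    qed
    then obtain p where p: "\<And>k. \<mu> (fst (p k)) (snd (p k)) \<noteq> 0"
      "\<And>k. \<bar>f (snd (p k))\<bar> + 1 < \<bar>f (snd (p (Suc k)))\<bar>" by blast
    define n x where "n k = fst (p k)" and "x k = snd (p k)" for k
    have nx: "\<mu> (n k) (x k) \<noteq> 0" "\<bar>f (x k)\<bar> + 1 < \<bar>f (x (Suc k))\<bar>" for k
      using p by (auto simp: n_def x_def)
    obtain \<Phi> where \<Phi>: "continuous_on UNIV \<Phi>" "\<And>k. \<Phi> \<bar>f (x k)\<bar> = real k / \<bar>\<mu> (n k) (x k)\<bar>"
      using continuous_majorant[of "\<lambda>k. \<bar>f (x k)\<bar>" "\<lambda>k. real k / \<bar>\<mu> (n k) (x k)\<bar>"] nx(2) by blast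
    let ?g = "\<lambda>y. \<Phi> \<bar>f y\<bar>"
    have "continuous_on UNIV (\<lambda>s. \<Phi> \<bar>s\<bar>)"
      using \<Phi>(1) by (rule continuous_on_compose2) (auto intro: continuous_intros)
    then have "continuous_map X euclideanreal ?g" by (rule continuous_map_real_compose[OF f])
    then have "Bseq (\<lambda>n. dual_norm (\<lambda>x. \<mu> n x * ?g x))"
      by (rule convergent_imp_Bseq[OF convergentI[OF null[rule_format]]])
    then obtain M where M: "\<And>n. \<bar>dual_norm (\<lambda>x. \<mu> n x * ?g x)\<bar> \<le> M"
      by (auto simp: Bseq_def)
    have "real k \<le> M" for k
    proof -
      have "real k = \<bar>\<mu> (n k) (x k) * ?g (x k)\<bar>"
        using nx(1)[of k] by (simp add: \<Phi>(2) abs_mult)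
      also have "\<dots> \<le> dual_norm (\<lambda>y. \<mu> (n k) y * ?g y)"
        unfolding dual_norm_mult[OF \<mu>] using nx(1)[of k] \<mu>[of "n k"]
        by (intro member_le_sum[where f = "\<lambda>y. \<bar>\<mu> (n k) y * ?g y\<bar>"]) (auto simp: Cp_dual_def)
      also have "\<dots> \<le> M" using M[of "n k"] by linarith
      finally show ?thesis .
    qed
    then show False using reals_Archimedean2[of M] by (meson not_le)
  qed
  then obtain B where "\<And>n x. \<mu> n x \<noteq> 0 \<Longrightarrow> \<bar>f x\<bar> \<le> B" by blast
  then show ?thesis by (intro that[of "max 1 B"]) (auto simp: le_max_iff_disj)
qed

lemma abs_dual_apply_le_norm:
  assumes "\<And>x. \<mu> x \<noteq> 0 \<Longrightarrow> \<bar>f x\<bar> \<le> B"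
  shows "\<bar>dual_apply \<mu> f\<bar> \<le> B * dual_norm \<mu>"
proof -
  have "\<bar>dual_apply \<mu> f\<bar> \<le> (\<Sum>x | \<mu> x \<noteq> 0. \<bar>\<mu> x * f x\<bar>)"
    unfolding dual_apply_def by (rule sum_abs)
  also have "\<dots> \<le> (\<Sum>x | \<mu> x \<noteq> 0. B * \<bar>\<mu> x\<bar>)"
    using assms by (intro sum_mono) (auto simp: abs_mult mult.commute intro!: mult_right_mono)
  finally show ?thesis by (simp add: dual_norm_def sum_distrib_left)
qed

text \<open>
  A sum \<open>\<Sum>k. c k * f k\<close> with coefficients so small that the series converges uniformly; the
  \<open>n\<close>-th measure takes the value \<open>c n\<close> at the sum.
\<close>

lemma biorthogonal_sum:
  fixes \<mu> :: "nat \<Rightarrow> 'a \<Rightarrow> real" and f :: "nat \<Rightarrow> 'a \<Rightarrow> real"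
  assumes \<mu>: "\<And>n. \<mu> n \<in> Cp_dual X"
    and f: "\<And>k. continuous_map X euclideanreal (f k)"
    and B: "\<And>k. 0 < B k" "\<And>k x. \<bar>f k x\<bar> \<le> B k"
    and bi: "\<And>n k. dual_apply (\<mu> n) (f k) = (if n = k then 1 else 0)"
  obtains G where "continuous_map X euclideanreal G" "\<And>n. dual_apply (\<mu> n) G \<noteq> 0"
proof -
  define c where "c k = (1 / 2) ^ k / B k" for k
  have le: "norm (c k * f k x) \<le> (1 / 2) ^ k" for k x
  proof -
    have "norm (c k * f k x) = c k * \<bar>f k x\<bar>" using B(1)[of k] by (simp add: c_def abs_mult)
    also have "\<dots> \<le> c k * B k" using B(1)[of k] B(2)[of k x] by (intro mult_left_mono) (auto simp: c_def)
    finally show ?thesis using B(1)[of k] by (simp add: c_def)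
  qed
  have geo: "summable (\<lambda>k. (1 / 2 :: real) ^ k)" by (rule summable_geometric) simp
  define G where "G x = (\<Sum>k. c k * f k x)" for x
  have "uniform_limit UNIV (\<lambda>N x. \<Sum>k<N. c k * f k x) G sequentially"
    unfolding G_def using le geo by (rule Weierstrass_m_test)
  then have unif: "\<forall>\<^sub>F N in sequentially. \<forall>x\<in>UNIV. dist (\<Sum>k<N. c k * f k x) (G x) < e" if "0 < e" for e
    using that by (rule uniform_limitD)
  have "continuous_map X euclideanreal G"
  proof (rule continuous_map_uniform_suminf)
    show "continuous_map X euclideanreal (\<lambda>x. c k * f k x)" for k
      using f by (rule continuous_map_real_mult_left)
    show "\<forall>\<^sub>F N in sequentially. \<forall>x\<in>topspace X. \<bar>G x - (\<Sum>k<N. c k * f k x)\<bar> < e" if "0 < e" for e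
      using unif[OF that] by eventually_elim (auto simp: dist_real_def abs_minus_commute)
  qed
  moreover have "dual_apply (\<mu> n) G \<noteq> 0" for n
  proof -
    have "(\<lambda>k. dual_apply (\<mu> n) (\<lambda>x. c k * f k x)) sums dual_apply (\<mu> n) G"
    proof (rule dual_apply_sums[OF \<mu>])
      show "(\<lambda>k. c k * f k x) sums G x" for x
        unfolding G_def using summable_comparison_test'[OF geo le] by (rule summable_sums)
    qed
    moreover have "dual_apply (\<mu> n) (\<lambda>x. c k * f k x) = (if k = n then c k else 0)" for k
      by (simp add: dual_apply_scale bi)
    ultimately have "dual_apply (\<mu> n) G = c n"
      using sums_single[of n c] by (simp add: sums_unique2)
    then show ?thesis using B(1)[of n] by (simp add: c_def)
  qed
  ultimately show ?thesis by (rule that)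
qed

text \<open>
  Move the entry \<open>x k\<close> to a position \<open>m k\<close> so far out that \<open>(k + 1) * a (m k) < \<bar>x k\<bar>\<close>.
\<close>

lemma symmetric_ideal_not_dominated:
  assumes E: "symmetric_sequence_ideal E" and x: "x \<in> E" "\<And>k. x k \<noteq> 0" and a: "a \<longlonglongrightarrow> (0::real)" "\<And>n. 0 \<le> a n"
  shows "\<exists>y\<in>E. \<forall>B. \<exists>n. B * a n < \<bar>y n\<bar>"
proof -
  have ev: "\<forall>\<^sub>F n in sequentially. real (Suc k) * a n < \<bar>x k\<bar>" for k
    using tendsto_mult_left[OF a(1), of "real (Suc k)"] x(2)[of k]
    by (intro order_tendstoD(2)[where y = "real (Suc k) * 0"]) auto
  have "\<exists>m :: nat \<Rightarrow> nat. \<forall>k. (\<forall>n\<ge>m k. real (Suc k) * a n < \<bar>x k\<bar>) \<and> m k < m (Suc k)"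
  proof (rule dependent_nat_choice)
    show "\<exists>m. \<forall>n\<ge>m. real (Suc 0) * a n < \<bar>x 0\<bar>" using ev[of 0] by (simp add: eventually_sequentially)
    fix m k
    obtain q where "\<forall>n\<ge>q. real (Suc (Suc k)) * a n < \<bar>x (Suc k)\<bar>"
      using ev[of "Suc k"] by (auto simp: eventually_sequentially)
    then show "\<exists>m'. (\<forall>n\<ge>m'. real (Suc (Suc k)) * a n < \<bar>x (Suc k)\<bar>) \<and> m < m'"
      by (intro exI[of _ "max q (Suc m)"]) auto
  qed
  then obtain m :: "nat \<Rightarrow> nat" where m: "\<And>k. real (Suc k) * a (m k) < \<bar>x k\<bar>" "strict_mono m"
    by (auto simp: strict_mono_Suc_iff)
  have inv: "inv m (m k) = k" for k using m(2) by (simp add: strict_mono_imp_inj_on)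
  define y where "y n = (if n \<in> range m then x (inv m n) else 0)" for n
  have ym: "y (m k) = x k" for k by (simp add: y_def inv)
  have "y \<in> c0"
    unfolding c0_def
  proof (intro CollectI tendstoI)
    fix e :: real assume "0 < e"
    have "x \<longlonglongrightarrow> 0" using E x(1) by (auto simp: symmetric_sequence_ideal_def c0_def)
    from tendstoD[OF this \<open>0 < e\<close>] obtain K where K: "\<And>k. k \<ge> K \<Longrightarrow> dist (x k) 0 < e"
      by (auto simp: eventually_sequentially)
    show "\<forall>\<^sub>F n in sequentially. dist (y n) 0 < e"
      using eventually_ge_at_top[of "m K"]
    proof eventually_elim
      case (elim n)
      show ?case
      proof (cases "n \<in> range m")
        case True
        then obtain k where k: "n = m k" by blast
        then have "K \<le> k" using elim m(2) by (simp add: strict_mono_less_eq)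
        then show ?thesis using K k ym by simp
      qed (use \<open>0 < e\<close> in \<open>simp add: y_def\<close>)
    qed
  qed
  then have "y \<in> E"
  proof (rule symmetric_sequence_ideal_memI[OF E x(1)])
    show "inj_on (inv m) {k. y k \<noteq> 0}"
      by (rule inj_on_subset[OF inj_on_inv_into[of "range m" m UNIV]]) (auto simp: y_def)
    show "\<bar>y k\<bar> \<le> \<bar>x (inv m k)\<bar>" for k by (simp add: y_def)
  qed
  moreover have "\<exists>n. B * a n < \<bar>y n\<bar>" for B
  proof -
    obtain k where k: "B \<le> real (Suc k)" by (meson real_arch_simple le_SucI of_nat_mono order_trans le_refl lessI less_imp_le)
    have "B * a (m k) \<le> real (Suc k) * a (m k)" using k a(2) by (intro mult_right_mono)
    then have "B * a (m k) < \<bar>x k\<bar>" using m(1)[of k] by linarith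
    then show ?thesis using ym by metis
  qed
  ultimately show ?thesis by blast
qed

lemma coordinate_measures:
  assumes X: "completely_regular_space X" "Hausdorff_space X"
    and T: "linear_between (Cp X) (seq_space E) T" "continuous_map (topo (Cp X)) (topo (seq_space E)) T"
  obtains \<mu> :: "nat \<Rightarrow> 'a \<Rightarrow> real" where "\<And>n. \<mu> n \<in> Cp_dual X"
    "\<And>f n. f \<in> vecs (Cp X) \<Longrightarrow> T f n = dual_apply (\<mu> n) f"
proof -
  have "\<exists>\<mu>\<in>Cp_dual X. \<forall>f\<in>vecs (Cp X). T f n = dual_apply \<mu> f" for n
  proof (rule functional_representation[OF X])
    show "T (vadd (Cp X) f g) n = T f n + T g n" if "f \<in> vecs (Cp X)" "g \<in> vecs (Cp X)" for f g
      using T(1) that by (simp add: linear_between_def seq_space_ops)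
    show "T (vscale (Cp X) c f) n = c * T f n" if "f \<in> vecs (Cp X)" for c f
      using T(1) that by (simp add: linear_between_def seq_space_ops)
    show "continuous_map (topo (Cp X)) euclideanreal (\<lambda>f. T f n)"
      using T(2) by (simp add: continuous_map_seq_space)
  qed
  then have "\<exists>\<mu>. \<forall>n. \<mu> n \<in> Cp_dual X \<and> (\<forall>f\<in>vecs (Cp X). T f n = dual_apply (\<mu> n) f)"
    by (intro choice) blast
  then show ?thesis using that by blast
qed

text \<open>
  To prescribe the values \<open>\<mu> (r k) f = y k\<close> of the unnormalized measures, one prescribes
  \<open>c k = y k / w (r k)\<close> for the normalized ones, a null sequence because \<open>w\<close> is bounded away
  from 0. The synthesis of \<open>forward_substitution a c\<close> takes these values, and multiplying it by
  \<open>g\<close> moves the weight from the measure to the function.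
\<close>

lemma JN_sequence_reaches_c0:
  fixes \<mu> :: "nat \<Rightarrow> 'a \<Rightarrow> real"
  assumes X: "completely_regular_space X" "Hausdorff_space X"
    and \<mu>: "\<And>n. \<mu> n \<in> Cp_dual X" and g: "continuous_map X euclideanreal g"
    and w: "0 < \<epsilon>" "\<And>k. \<epsilon> \<le> w k" and JN: "JN_sequence X (\<lambda>k x. \<mu> k x * (g x / w k))"
  obtains r where "strict_mono r"
    "\<And>y. y \<in> c0 \<Longrightarrow> \<exists>f. continuous_map X euclideanreal f \<and> (\<forall>k. dual_apply (\<mu> (r k)) f = y k)"
proof -
  let ?\<nu> = "\<lambda>k x. \<mu> k x * (g x / w k)"
  obtain r a R S where r: "strict_mono r" and a: "\<And>k. a k k \<noteq> 0"
      "\<And>y. y \<in> c0 \<Longrightarrow> forward_substitution a y \<in> c0"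
    and R: "\<And>f. R f = forward_substitution a (\<lambda>k. dual_apply (?\<nu> (r k)) f)"
    and S: "linear_between (seq_space c0) (Cp X) S" and RS: "\<And>c. c \<in> c0 \<Longrightarrow> R (S c) = c"
    by (rule JN_sequence_retraction[OF X JN]) (rule that)
  have "\<exists>f. continuous_map X euclideanreal f \<and> (\<forall>k. dual_apply (\<mu> (r k)) f = y k)"
    if y: "y \<in> c0" for y
  proof -
    define c where "c k = y k / w (r k)" for k
    have wpos: "0 < w k" for k using w(1) w(2)[of k] by linarith
    have "c \<in> c0"
      unfolding c0_def mem_Collect_eq
    proof (rule Lim_null_comparison)
      show "(\<lambda>k. inverse \<epsilon> * norm (y k)) \<longlonglongrightarrow> 0"
        using tendsto_mult_left[OF tendsto_norm_zero, of y sequentially "inverse \<epsilon>"] y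
        by (simp add: c0_def)
      show "\<forall>\<^sub>F k in sequentially. norm (c k) \<le> inverse \<epsilon> * norm (y k)"
      proof (intro always_eventually allI)
        fix k
        have "inverse (w (r k)) \<le> inverse \<epsilon>" using w(2) w(1) by (rule le_imp_inverse_le)
        then have "inverse (w (r k)) * \<bar>y k\<bar> \<le> inverse \<epsilon> * \<bar>y k\<bar>"
          by (rule mult_right_mono) simp
        then show "norm (c k) \<le> inverse \<epsilon> * norm (y k)"
          using wpos[of "r k"] by (simp add: c_def divide_inverse abs_mult mult.commute)
      qed
    qed
    define d where "d = forward_substitution a c"
    have d: "d \<in> c0" unfolding d_def using \<open>c \<in> c0\<close> by (rule a(2))
    define f where "f = S d"
    have "f \<in> vecs (Cp X)" using S d by (auto simp: f_def linear_between_def vecs_seq_space)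
    then have f: "continuous_map X euclideanreal f" by (rule vecs_CpD)
    have val: "dual_apply (\<mu> (r k)) (\<lambda>x. g x * f x) = y k" for k
    proof -
      have Rf: "forward_substitution a (\<lambda>k. dual_apply (?\<nu> (r k)) f) = d"
        using RS[OF d] by (simp add: R f_def)
      have "(\<Sum>j\<le>k. a k j * forward_substitution a (\<lambda>k. dual_apply (?\<nu> (r k)) f) j)
          = dual_apply (?\<nu> (r k)) f"
        by (rule forward_substitution_solves) (rule a)
      then have "dual_apply (?\<nu> (r k)) f = (\<Sum>j\<le>k. a k j * d j)"
        unfolding Rf by (rule sym)
      also have "\<dots> = c k"
        unfolding d_def by (rule forward_substitution_solves) (rule a)
      finally have "dual_apply (?\<nu> (r k)) f = c k" .
      moreover have "dual_apply (?\<nu> (r k)) f = inverse (w (r k)) * dual_apply (\<mu> (r k)) (\<lambda>x. g x * f x)"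
        unfolding dual_apply_mult[OF \<mu>] dual_apply_scale [symmetric]
        by (simp add: divide_inverse mult_ac)
      ultimately show ?thesis using wpos[of "r k"] by (simp add: c_def field_simps)
    qed
    then show ?thesis using continuous_map_real_mult[OF g f] by blast
  qed
  then show ?thesis using r that by blast
qed

text \<open>
  Suppose that all weighted norms tend to 0, so that continuous functions are bounded on the supports.
  Truncated preimages of the unit vectors are then still preimages of the unit vectors, and they sum
  up to a preimage of a sequence without zero entries. By \<open>symmetric_ideal_not_dominated\<close>, some
  element of \<open>E\<close> is not \<open>O(\<parallel>\<mu> n\<parallel>)\<close>; but all of them are, again because functions are
  bounded on the supports.
\<close>

lemma surjection_weight_exists:
  fixes \<mu> :: "nat \<Rightarrow> 'a \<Rightarrow> real"
  assumes E: "symmetric_sequence_ideal E" "E \<noteq> {\<lambda>_. 0}"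
    and \<mu>: "\<And>n. \<mu> n \<in> Cp_dual X"
    and onto: "\<forall>y\<in>E. \<exists>f. continuous_map X euclideanreal f \<and> (\<forall>n. dual_apply (\<mu> n) f = y n)"
    and into: "\<forall>f. continuous_map X euclideanreal f \<longrightarrow> (\<lambda>n. dual_apply (\<mu> n) f) \<in> E"
  obtains g where "continuous_map X euclideanreal g"
    "\<not> (\<lambda>n. dual_norm (\<lambda>x. \<mu> n x * g x)) \<longlonglongrightarrow> 0"
proof -
  have "\<exists>g. continuous_map X euclideanreal g \<and> \<not> (\<lambda>n. dual_norm (\<lambda>x. \<mu> n x * g x)) \<longlonglongrightarrow> 0"
  proof (rule ccontr)
    assume "\<not> ?thesis"
    then have null: "\<forall>g. continuous_map X euclideanreal g \<longrightarrow>
        (\<lambda>n. dual_norm (\<lambda>x. \<mu> n x * g x)) \<longlonglongrightarrow> 0" by blast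
    have "\<exists>f B. continuous_map X euclideanreal f \<and> 0 < B \<and> (\<forall>x. \<bar>f x\<bar> \<le> B) \<and>
        (\<forall>n. dual_apply (\<mu> n) f = (if n = k then 1 else 0))" for k
    proof -
      from onto[rule_format, OF symmetric_sequence_ideal_unit[OF E, of k]]
      obtain F where F: "continuous_map X euclideanreal F"
        "\<And>n. dual_apply (\<mu> n) F = (if n = k then 1 else 0)"
        by auto
      obtain B where B: "0 < B" "\<And>n x. \<mu> n x \<noteq> 0 \<Longrightarrow> \<bar>F x\<bar> \<le> B"
        by (rule bounded_on_supports[OF \<mu> null F(1)]) (rule that)
      \<comment> \<open>Truncation does not change \<open>F\<close> on the supports, so all \<open>\<mu> n\<close> take the same values.\<close>
      let ?f = "\<lambda>x. max (- B) (min B (F x))"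
      have "continuous_map X euclideanreal ?f"
        by (rule continuous_map_real_compose[OF F(1)]) (intro continuous_intros)
      moreover have "dual_apply (\<mu> n) ?f = dual_apply (\<mu> n) F" for n
        unfolding dual_apply_def
      proof (intro sum.cong refl)
        fix x assume "x \<in> {x. \<mu> n x \<noteq> 0}"
        then have "\<bar>F x\<bar> \<le> B" using B(2) by blast
        then show "\<mu> n x * ?f x = \<mu> n x * F x" by auto
      qed
      moreover have "\<bar>?f x\<bar> \<le> B" for x using B(1) by auto
      ultimately show ?thesis using F(2) B(1) by (intro exI[of _ ?f] exI[of _ B]) auto
    qed
    then have "\<exists>f. \<forall>k. \<exists>B. continuous_map X euclideanreal (f k) \<and> 0 < B \<and> (\<forall>x. \<bar>f k x\<bar> \<le> B) \<and>
        (\<forall>n. dual_apply (\<mu> n) (f k) = (if n = k then 1 else 0))"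
      by (intro choice allI)
    then obtain f where "\<forall>k. \<exists>B. continuous_map X euclideanreal (f k) \<and> 0 < B \<and> (\<forall>x. \<bar>f k x\<bar> \<le> B) \<and>
        (\<forall>n. dual_apply (\<mu> n) (f k) = (if n = k then 1 else 0))" ..
    then have "\<exists>B. \<forall>k. continuous_map X euclideanreal (f k) \<and> 0 < B k \<and> (\<forall>x. \<bar>f k x\<bar> \<le> B k) \<and>
        (\<forall>n. dual_apply (\<mu> n) (f k) = (if n = k then 1 else 0))"
      by (rule choice)
    then obtain B where fB: "\<forall>k. continuous_map X euclideanreal (f k) \<and> 0 < B k \<and> (\<forall>x. \<bar>f k x\<bar> \<le> B k) \<and>
        (\<forall>n. dual_apply (\<mu> n) (f k) = (if n = k then 1 else 0))" ..
    then have f: "continuous_map X euclideanreal (f k)" "0 < B k" "\<bar>f k x\<bar> \<le> B k"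
      "dual_apply (\<mu> n) (f k) = (if n = k then 1 else 0)" for k x n
      by simp_all
    obtain G where G: "continuous_map X euclideanreal G" "\<And>n. dual_apply (\<mu> n) G \<noteq> 0"
      by (rule biorthogonal_sum[OF \<mu> f]) (rule that)
    have "(\<lambda>n. dual_norm (\<mu> n)) \<longlonglongrightarrow> 0" using null[rule_format, of "\<lambda>_. 1"] by simp
    then obtain y where y: "y \<in> E" "\<And>B. \<exists>n. B * dual_norm (\<mu> n) < \<bar>y n\<bar>"
      using symmetric_ideal_not_dominated[OF E(1) into[rule_format, OF G(1)] G(2), of "\<lambda>n. dual_norm (\<mu> n)"]
      by (auto simp: dual_norm_nonneg)
    obtain g where g: "continuous_map X euclideanreal g" "\<And>n. dual_apply (\<mu> n) g = y n"
      using onto y(1) by blast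
    obtain B where B: "\<And>n x. \<mu> n x \<noteq> 0 \<Longrightarrow> \<bar>g x\<bar> \<le> B"
      by (rule bounded_on_supports[OF \<mu> null g(1)]) (rule that)
    have "\<bar>y n\<bar> \<le> B * dual_norm (\<mu> n)" for n
      unfolding g(2) [symmetric] by (rule abs_dual_apply_le_norm[OF B])
    then show False using y(2)[of B] by (meson not_le)
  qed
  then show ?thesis using that by blast
qed

lemma surjection_onto_symmetric_ideal:
  assumes X: "completely_regular_space X" "Hausdorff_space X"
    and E: "symmetric_sequence_ideal E" "E \<noteq> {\<lambda>_. 0}"
    and T: "linear_between (Cp X) (seq_space E) T" "continuous_map (topo (Cp X)) (topo (seq_space E)) T"
      "T ` vecs (Cp X) = E"
  shows "E = c0" "Josefson_Nissenzweig X"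
proof -
  obtain \<mu> :: "nat \<Rightarrow> 'a \<Rightarrow> real" where \<mu>: "\<And>n. \<mu> n \<in> Cp_dual X"
    and T\<mu>: "\<And>f n. f \<in> vecs (Cp X) \<Longrightarrow> T f n = dual_apply (\<mu> n) f"
    by (rule coordinate_measures[OF X T(1,2)]) (rule that)
  have into: "\<forall>f. continuous_map X euclideanreal f \<longrightarrow> (\<lambda>n. dual_apply (\<mu> n) f) \<in> E"
  proof (intro allI impI)
    fix f assume that: "continuous_map X euclideanreal f"
    have f: "restrict f (topspace X) \<in> vecs (Cp X)" using that by (rule restrict_in_Cp)
    have "(\<lambda>n. dual_apply (\<mu> n) f) = T (restrict f (topspace X))"
      by (simp add: T\<mu>[OF f] dual_apply_restrict[OF \<mu>] fun_eq_iff)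
    then show "(\<lambda>n. dual_apply (\<mu> n) f) \<in> E" using f T(3) by auto
  qed
  have onto: "\<forall>y\<in>E. \<exists>f. continuous_map X euclideanreal f \<and> (\<forall>n. dual_apply (\<mu> n) f = y n)"
  proof
    fix y assume "y \<in> E"
    then obtain f where f: "f \<in> vecs (Cp X)" "y = T f" using T(3) by blast
    then show "\<exists>f. continuous_map X euclideanreal f \<and> (\<forall>n. dual_apply (\<mu> n) f = y n)"
      using T\<mu>[OF f(1)] vecs_CpD(1)[OF f(1)] by (intro exI[of _ f]) simp
  qed
  have Ec0: "E \<subseteq> c0" using E(1) by (simp add: symmetric_sequence_ideal_def)
  then have null: "\<forall>f. continuous_map X euclideanreal f \<longrightarrow> (\<lambda>n. dual_apply (\<mu> n) f) \<longlonglongrightarrow> 0"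
    using into by (auto simp: c0_def)
  obtain g where g: "continuous_map X euclideanreal g"
    "\<not> (\<lambda>n. dual_norm (\<lambda>x. \<mu> n x * g x)) \<longlonglongrightarrow> 0"
    by (rule surjection_weight_exists[OF E \<mu> onto into]) (rule that)
  obtain m w \<epsilon> where m: "strict_mono m" "0 < \<epsilon>" "\<And>k. \<epsilon> \<le> w k"
    and JN: "JN_sequence X (\<lambda>k x. \<mu> (m k) x * (g x / w k))"
    by (rule JN_sequence_from_weight[OF \<mu> null g]) (rule that)
  show "Josefson_Nissenzweig X"
    using JN Josefson_Nissenzweig_iff_JN_sequence by blast
  obtain r where r: "strict_mono r"
    "\<And>y. y \<in> c0 \<Longrightarrow> \<exists>f. continuous_map X euclideanreal f \<and> (\<forall>k. dual_apply (\<mu> (m (r k))) f = y k)"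
    by (rule JN_sequence_reaches_c0[OF X \<mu> g(1) m(2,3) JN]) (rule that)
  \<comment> \<open>Every null sequence is a subsequence of coordinates of an element of \<open>E\<close>, hence lies in \<open>E\<close> by symmetry.\<close>
  have "c0 \<subseteq> E"
  proof
    fix y assume y: "y \<in> c0"
    obtain f where f: "continuous_map X euclideanreal f" "\<And>k. dual_apply (\<mu> (m (r k))) f = y k"
      using r(2)[OF y] by blast
    show "y \<in> E"
    proof (rule symmetric_sequence_ideal_memI[OF E(1) into[rule_format, OF f(1)] y])
      have "inj (m \<circ> r)" using strict_mono_o[OF m(1) r(1)] by (rule strict_mono_imp_inj_on)
      then show "inj_on (m \<circ> r) {k. y k \<noteq> 0}" by (rule inj_on_subset) simp
    qed (simp add: f(2))
  qed
  with Ec0 show "E = c0" by blast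
qed

section \<open>The equivalence\<close>

theorem corollary1p4:
  fixes X :: "'a topology" and E :: "(nat \<Rightarrow> real) set"
  assumes "completely_regular_space X" and "Hausdorff_space X"
    and "symmetric_sequence_ideal E" and "E \<noteq> {\<lambda>_. 0}"
  defines "cond_i \<equiv>
      (\<exists>T. linear_between (Cp X) (seq_space E) T \<and>
           continuous_map (topo (Cp X)) (topo (seq_space E)) T \<and>
           T ` vecs (Cp X) = vecs (seq_space E))"
    and "cond_ii \<equiv> E = c0 \<and> Josefson_Nissenzweig X"
    and "cond_iii \<equiv> E = c0 \<and>
      (\<exists>S. complemented_in (Cp X) S \<and> isomorphic (subspace_of (Cp X) S) (seq_space c0))"
    and "cond_iv \<equiv> E = c0 \<and>
      (\<exists>N. linear_subspace (Cp X) N \<and> closedin (topo (Cp X)) N \<and>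
           isomorphic (quotient_space (Cp X) N) (seq_space c0))"
  shows "(cond_i \<longleftrightarrow> cond_ii) \<and> (cond_ii \<longleftrightarrow> cond_iii) \<and> (cond_iii \<longleftrightarrow> cond_iv)"
proof -
  note X = assms(1,2)
  have i_ii: "cond_i \<Longrightarrow> cond_ii"
    using surjection_onto_symmetric_ideal[OF assms(1-4)]
    unfolding cond_i_def cond_ii_def vecs_seq_space by blast
  have ii_iii_iv: "cond_iii \<and> cond_iv" if ii: cond_ii
  proof -
    obtain \<nu> where JN: "JN_sequence X \<nu>" and E: "E = c0"
      using ii by (auto simp: cond_ii_def Josefson_Nissenzweig_iff_JN_sequence)
    obtain R S where R: "linear_between (Cp X) (seq_space c0) R"
        "continuous_map (topo (Cp X)) (topo (seq_space c0)) R"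
      and S: "linear_between (seq_space c0) (Cp X) S"
        "continuous_map (topo (seq_space c0)) (topo (Cp X)) S"
      and RS: "\<And>c. c \<in> c0 \<Longrightarrow> R (S c) = c"
      by (rule JN_sequence_retraction[OF X JN]) (rule that)
    have RS': "\<forall>c\<in>vecs (seq_space c0). R (S c) = c"
      using RS by (simp add: vecs_seq_space)
    have cond_iii
      unfolding cond_iii_def
      using E retraction_gives_complement[OF R S _ linear_subspace_c0, OF RS'] by blast
    moreover have cond_iv
      unfolding cond_iv_def using E retraction_gives_quotient[OF R S(2), OF RS'] by blast
    ultimately show ?thesis ..
  qed
  have "cond_iii \<Longrightarrow> cond_i"
    unfolding cond_iii_def cond_i_def using surjection_from_complement by blast
  moreover have "cond_iv \<Longrightarrow> cond_i"
    unfolding cond_iv_def cond_i_def using surjection_from_quotient by blast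
  ultimately show ?thesis using i_ii ii_iii_iv by blast
qed

end
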